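(* Let $V$ be a 2-dimensional complex vector space and let $0\le\theta\le\pi$. Let $R=R(\theta):V^{\otimes 3}\to V^{\otimes 3}$ be the $(2,3,1)$ generalized Yang-Baxter operator of type II, i.e. the operator represented on the lexicographically ordered basis of $V^{\otimes 3}$ by $$R(\theta)=\frac{1}{\sqrt{2}}\begin{pmatrix}1&0&1&0\\ 0&i&0&e^{i\theta}\\ -1&0&1&0\\ 0&e^{-i\theta}&0&i\end{pmatrix}\oplus\frac{1}{\sqrt{2}}\begin{pmatrix}i&0&e^{i\theta}&0\\ 0&1&0&-e^{2i\theta}\\ e^{-i\theta}&0&i&0\\ 0&e^{-2i\theta}&0&1\end{pmatrix}.$$ Let $\mu=\mathrm{Id}_V$, $\alpha=e^{i\pi/4}$, $\beta=1$. Then $S=(R,\mu,\alpha,\beta)$ is an enhanced generalized Yang-Baxter operator (with $k=3$, $m=1$) whose associated oriented link invariant $T_S$ satisfies $T_S(G_n)=2^{n+1}$ for all $n\ge 1$, where $G_n$ is the trivial $n$-component link.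
   Context: $V$ is a finite-dimensional complex vector space of dimension $d$; $I_m$ denotes the identity of $V^{\otimes m}$. $B_n$ is the braid group with generators $\sigma_1,\dots,\sigma_{n-1}$ (positive crossings) and relations $\sigma_i\sigma_j=\sigma_j\sigma_i$ for $|i-j|\ge 2$, $\sigma_i\sigma_{i+1}\sigma_i=\sigma_{i+1}\sigma_i\sigma_{i+1}$. Operator trace. For a basis $v_1,\dots,v_d$ of $V$ and $f\in\mathrm{End}(V^{\otimes k})$ write $f(v_{i_1}\otimes\cdots\otimes v_{i_k})=\sum f^{j_1,\dots,j_k}_{i_1,\dots,i_k}v_{j_1}\otimes\cdots\otimes v_{j_k}$. For $m<k$, $\mathrm{Sp}_{k,m}:\mathrm{End}(V^{\otimes k})\to\mathrm{End}(V^{\otimes (k-m)})$ is the partial trace over the last $m$ tensor factors: $\mathrm{Sp}_{k,m}(f)(v_{i_1}\otimes\cdots\otimes v_{i_{k-m}})=\sum_{j_1,\dots,j_{k-m},l_1,\dots,l_m}f^{j_1,\dots,j_{k-m},l_1,\dots,l_m}_{i_1,\dots,i_{k-m},l_1,\dots,l_m}v_{j_1}\otimes\cdots\otimes v_{j_{k-m}}$ (independent of the basis). Generalized Yang-Baxter operator (gYB-operator) of type $(d,k,m)$: an isomorphism $R:V^{\otimes k}\to V^{\otimes k}$, $\dim V=d$, with $(R\otimes I_m)(I_m\otimes R)(R\otimes I_m)=(I_m\otimes R)(R\otimes I_m)(I_m\otimes R)$ and $(R\otimes I_m^{\otimes(j-2)})(I_m^{\otimes(j-2)}\otimes R)=(I_m^{\otimes(j-2)}\otimes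 R)(R\otimes I_m^{\otimes(j-2)})$ for all $j\ge 4$. It gives a representation $\rho^R_n:B_n\to\mathrm{End}(V^{\otimes k+m(n-2)})$, $\sigma_i\mapsto I_m^{\otimes(i-1)}\otimes R\otimes I_m^{\otimes(n-i-1)}$, with image $\mathrm{im}(\rho^R_n)$. It is known (R. S. Chen) that the displayed $R(\theta)$ is a unitary gYB-operator of type $(2,3,1)$. Perpendicular subspace: for $A\subset\mathrm{End}(W)$, $A^\perp=\{g\in\mathrm{End}(W):\mathrm{tr}(f^*\circ g)=0\text{ for all }f\in A\}$, where $f^*$ is the hermitian conjugate of $f$ (conjugate transpose in the tensor basis induced by the fixed basis of $V$). Enhanced generalized Yang-Baxter operator (EgYB-operator): fix positive integers $m<k$. It is a collection $S=(R,\mu,\alpha,\beta)$ of a gYB-operator $R:V^{\otimes k}\to V^{\otimes k}$ of type $(d,k,m)$, a linear map $\mu:V\to V$, and invertible $\alpha,\beta\in\mathbb{C}$ such that, for all $n\geq 1$: (i) $\mu^{\otimes k}$ commutes with $R$; (ii) $\mu^{\otimes m(n-1)}\otimes(\mathrm{Sp}_{k,m}(R\circ\mu^{\otimes k})-\alpha\beta\mu^{\otimes (k-m)})\in\mathrm{im}(\rho^R_n)^\perp$ and $\mu^{\otimes m(n-1)}\otimes(\mathrm{Sp}_{k,m}(R^{-1}\circ\mu^{\otimes k})-\alpha^{-1}\beta\mu^{\otimes (k-m)})\in\mathrm{im}(\rho^R_n)^\perp$. The invariant $T_S$: let $w:B_n\to\mathbb{Z}$ be the homomorphism with $w(\sigma_i)=1$.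 For $\xi\in B_n$, $T_S(\xi)=\alpha^{-w(\xi)}\beta^{-n}\,\mathrm{tr}\big(\rho^R_n(\xi)\circ\mu^{\otimes k+m(n-2)}\big)$. For an oriented link $L$, $T_S(L)=T_S(\xi)$ where $\xi$ is any braid whose closure is isotopic to $L$ (well defined, by invariance under Markov moves and Markov's theorem). *)

theory Defs
  imports
    "HOL-Analysis.Path_Connected"
    "Jordan_Normal_Form.Schur_Decomposition"
    "Jordan_Normal_Form.Gauss_Jordan_Elimination"
begin

section \<open>Operators on tensor powers\<close>

text \<open>
  A \<open>d\<close>-dimensional space \<open>V\<close> with a fixed basis is identified with coordinate space, so that
  \<open>End(V\<^sup>\<otimes>\<^sup>k)\<close> is \<open>carrier_mat (d ^ k) (d ^ k)\<close>; the tensor basis is ordered lexicographically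
  and numbered from 0.  Column \<open>i\<close> of a matrix is the image of the \<open>i\<close>-th basis vector.
\<close>

definition kron :: "complex mat \<Rightarrow> complex mat \<Rightarrow> complex mat" where
  "kron A B = mat (dim_row A * dim_row B) (dim_col A * dim_col B)
     (\<lambda>(i, j). A $$ (i div dim_row B, j div dim_col B) * B $$ (i mod dim_row B, j mod dim_col B))"

fun kron_pow :: "complex mat \<Rightarrow> nat \<Rightarrow> complex mat" where
  "kron_pow A 0 = 1\<^sub>m 1"
| "kron_pow A (Suc n) = kron A (kron_pow A n)"

definition mat_trace :: "complex mat \<Rightarrow> complex" where
  "mat_trace A = (\<Sum>i<dim_row A. A $$ (i, i))"

definition mat_inv :: "complex mat \<Rightarrow> complex mat" where
  "mat_inv A = the (mat_inverse A)"

text \<open>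
  The partial trace \<open>Sp\<^bsub>k,m\<^esub>\<close> over the last \<open>m\<close> factors: the basis vector with multi-index
  \<open>(j\<^sub>1,\<dots>,j\<^bsub>k-m\<^esub>,l\<^sub>1,\<dots>,l\<^sub>m)\<close> has number \<open>j * d ^ m + l\<close>, where \<open>j\<close> and \<open>l\<close> are the numbers of
  \<open>(j\<^sub>1,\<dots>,j\<^bsub>k-m\<^esub>)\<close> and \<open>(l\<^sub>1,\<dots>,l\<^sub>m)\<close>.
\<close>

definition partial_trace :: "nat \<Rightarrow> nat \<Rightarrow> nat \<Rightarrow> complex mat \<Rightarrow> complex mat" where
  "partial_trace d k m f = mat (d ^ (k - m)) (d ^ (k - m))
     (\<lambda>(j, i). \<Sum>l<d ^ m. f $$ (j * d ^ m + l, i * d ^ m + l))"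

definition perp :: "nat \<Rightarrow> complex mat set \<Rightarrow> complex mat set" where
  "perp N A = {g \<in> carrier_mat N N. \<forall>f\<in>A. mat_trace (mat_adjoint f * g) = 0}"


section \<open>The braid groups\<close>

text \<open>
  The letter \<open>(i, True)\<close> stands for \<open>\<sigma>\<^sub>i\<close> and \<open>(i, False)\<close> for its inverse.  The group \<open>B\<^sub>n\<close> is the
  set of words modulo the congruence generated by the braid relations and free cancellation.
\<close>

type_synonym letter = "nat \<times> bool"

definition braid_words :: "nat \<Rightarrow> letter list set" where
  "braid_words n = {w. \<forall>(i, b)\<in>set w. 1 \<le> i \<and> i < n}"

inductive_set braid_rel :: "nat \<Rightarrow> (letter list \<times> letter list) set" for n :: nat where
  refl: "u \<in> braid_words n \<Longrightarrow> (u, u) \<in> braid_rel n"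
| sym: "(u, v) \<in> braid_rel n \<Longrightarrow> (v, u) \<in> braid_rel n"
| trans: "(u, v) \<in> braid_rel n \<Longrightarrow> (v, w) \<in> braid_rel n \<Longrightarrow> (u, w) \<in> braid_rel n"
| cancel: "u \<in> braid_words n \<Longrightarrow> v \<in> braid_words n \<Longrightarrow> 1 \<le> i \<Longrightarrow> i < n \<Longrightarrow>
    (u @ [(i, b), (i, \<not> b)] @ v, u @ v) \<in> braid_rel n"
| far: "u \<in> braid_words n \<Longrightarrow> v \<in> braid_words n \<Longrightarrow> 1 \<le> i \<Longrightarrow> i + 2 \<le> j \<Longrightarrow> j < n \<Longrightarrow>
    (u @ [(i, True), (j, True)] @ v, u @ [(j, True), (i, True)] @ v) \<in> braid_rel n"
| braid: "u \<in> braid_words n \<Longrightarrow> v \<in> braid_words n \<Longrightarrow> 1 \<le> i \<Longrightarrow> i + 1 < n \<Longrightarrow>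
    (u @ [(i, True), (i + 1, True), (i, True)] @ v,
     u @ [(i + 1, True), (i, True), (i + 1, True)] @ v) \<in> braid_rel n"

definition braid_class :: "nat \<Rightarrow> letter list \<Rightarrow> letter list set" where
  "braid_class n w = braid_rel n `` {w}"

definition braid_group :: "nat \<Rightarrow> letter list set monoid" where
  "braid_group n = \<lparr>carrier = braid_words n // braid_rel n,
     monoid.mult = (\<lambda>X Y. \<Union>x\<in>X. \<Union>y\<in>Y. braid_class n (x @ y)),
     one = braid_class n []\<rparr>"

definition word_exponent :: "letter list \<Rightarrow> int" where
  "word_exponent w = (\<Sum>(i, b)\<leftarrow>w. if b then 1 else - 1)"

text \<open>
  The homomorphism \<open>w : B\<^sub>n \<rightarrow> \<int>\<close>.  Here and in \<open>gyb_rep\<close> below, \<open>the_elem\<close> picks the common value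
  on all words representing a braid.
\<close>

definition braid_exponent :: "letter list set \<Rightarrow> int" where
  "braid_exponent \<xi> = the_elem (word_exponent ` \<xi>)"


section \<open>Generalized Yang-Baxter operators and their enhancements\<close>

definition gyb_operator :: "nat \<Rightarrow> nat \<Rightarrow> nat \<Rightarrow> complex mat \<Rightarrow> bool" where
  "gyb_operator d k m R \<longleftrightarrow>
     R \<in> carrier_mat (d ^ k) (d ^ k) \<and> invertible_mat R \<and>
     (let I = 1\<^sub>m (d ^ m) in
        kron R I * kron I R * kron R I = kron I R * kron R I * kron I R) \<and>
     (\<forall>j\<ge>4. let J = 1\<^sub>m (d ^ (m * (j - 2))) in kron R J * kron J R = kron J R * kron R J)"

definition gyb_gen :: "nat \<Rightarrow> nat \<Rightarrow> complex mat \<Rightarrow> nat \<Rightarrow> nat \<Rightarrow> complex mat" where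
  "gyb_gen d m R n i =
     kron (1\<^sub>m (d ^ (m * (i - 1)))) (kron R (1\<^sub>m (d ^ (m * (n - i - 1)))))"

text \<open>
  The number \<open>k + m(n-2)\<close> of tensor factors, written so that truncated subtraction is
  harmless for \<open>n = 1\<close> (it is \<open>k - m\<close> there, with \<open>m < k\<close>).
\<close>

definition gyb_len :: "nat \<Rightarrow> nat \<Rightarrow> nat \<Rightarrow> nat" where
  "gyb_len k m n = k + m * n - 2 * m"

definition gyb_word :: "nat \<Rightarrow> nat \<Rightarrow> nat \<Rightarrow> complex mat \<Rightarrow> nat \<Rightarrow> letter list \<Rightarrow> complex mat" where
  "gyb_word d k m R n w =
     foldr (\<lambda>(i, b) M. (if b then gyb_gen d m R n i else mat_inv (gyb_gen d m R n i)) * M)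
       w (1\<^sub>m (d ^ gyb_len k m n))"

definition gyb_rep :: "nat \<Rightarrow> nat \<Rightarrow> nat \<Rightarrow> complex mat \<Rightarrow> nat \<Rightarrow> letter list set \<Rightarrow> complex mat" where
  "gyb_rep d k m R n \<xi> = the_elem (gyb_word d k m R n ` \<xi>)"

definition egyb_operator ::
  "nat \<Rightarrow> nat \<Rightarrow> nat \<Rightarrow> complex mat \<Rightarrow> complex mat \<Rightarrow> complex \<Rightarrow> complex \<Rightarrow> bool" where
  "egyb_operator d k m R \<mu> \<alpha> \<beta> \<longleftrightarrow>
     0 < m \<and> m < k \<and> gyb_operator d k m R \<and> \<mu> \<in> carrier_mat d d \<and> \<alpha> \<noteq> 0 \<and> \<beta> \<noteq> 0 \<and>
     kron_pow \<mu> k * R = R * kron_pow \<mu> k \<and>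
     (\<forall>n\<ge>1. let P = perp (d ^ gyb_len k m n) (gyb_rep d k m R n ` carrier (braid_group n)) in
        kron (kron_pow \<mu> (m * (n - 1)))
          (partial_trace d k m (R * kron_pow \<mu> k) - (\<alpha> * \<beta>) \<cdot>\<^sub>m kron_pow \<mu> (k - m)) \<in> P \<and>
        kron (kron_pow \<mu> (m * (n - 1)))
          (partial_trace d k m (mat_inv R * kron_pow \<mu> k)
             - (inverse \<alpha> * \<beta>) \<cdot>\<^sub>m kron_pow \<mu> (k - m)) \<in> P)"

definition braid_invariant ::
  "nat \<Rightarrow> nat \<Rightarrow> nat \<Rightarrow> complex mat \<Rightarrow> complex mat \<Rightarrow> complex \<Rightarrow> complex
     \<Rightarrow> nat \<Rightarrow> letter list set \<Rightarrow> complex" where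
  "braid_invariant d k m R \<mu> \<alpha> \<beta> n \<xi> =
     \<alpha> powi (- braid_exponent \<xi>) * \<beta> powi (- int n) *
     mat_trace (gyb_rep d k m R n \<xi> * kron_pow \<mu> (gyb_len k m n))"


section \<open>Oriented links, braid closures, Markov's theorem\<close>

text \<open>
  Euclidean 3-space is \<open>\<complex> \<times> \<real>\<close>.  An oriented link is a list of disjoint parametrized simple closed
  curves; the order of the list and the parametrizations (but not their directions) are
  immaterial, because they are divided out in \<open>link_isotopic\<close>.
\<close>

type_synonym space = "complex \<times> real"
type_synonym curve = "real \<Rightarrow> space"

definition oriented_link :: "curve list \<Rightarrow> bool" where
  "oriented_link L \<longleftrightarrow>
     (\<forall>\<gamma>\<in>set L. simple_path \<gamma> \<and> pathfinish \<gamma> = pathstart \<gamma>) \<and>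
     (\<forall>i<length L. \<forall>j<length L. i \<noteq> j \<longrightarrow> path_image (L ! i) \<inter> path_image (L ! j) = {})"

text \<open>Orientation-preserving reparametrization of closed curves, base point changes included.\<close>

definition same_oriented_loop :: "curve \<Rightarrow> curve \<Rightarrow> bool" where
  "same_oriented_loop \<gamma> \<delta> \<longleftrightarrow>
     (\<exists>\<phi> :: real \<Rightarrow> real. continuous_on {0..1} \<phi> \<and> strict_mono_on {0..1} \<phi> \<and> \<phi> 1 = \<phi> 0 + 1 \<and>
        (\<forall>t\<in>{0..1}. \<delta> t = \<gamma> (frac (\<phi> t))))"

definition ambient_isotopy :: "(real \<Rightarrow> space \<Rightarrow> space) \<Rightarrow> bool" where
  "ambient_isotopy H \<longleftrightarrow>
     continuous_on ({0..1} \<times> UNIV) (\<lambda>(t, x). H t x) \<and>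
     (\<forall>t\<in>{0..1}. \<exists>g. homeomorphism UNIV UNIV (H t) g) \<and>
     (\<forall>x. H 0 x = x)"

definition link_isotopic :: "curve list \<Rightarrow> curve list \<Rightarrow> bool" where
  "link_isotopic L L' \<longleftrightarrow>
     (\<exists>H \<pi>. ambient_isotopy H \<and> bij_betw \<pi> {..<length L} {..<length L'} \<and>
        (\<forall>i<length L. same_oriented_loop (H 1 \<circ> L ! i) (L' ! \<pi> i)))"

text \<open>
  The trivial link with \<open>n\<close> components: round circles bounding flat discs in \<open>n\<close> distinct
  horizontal planes.
\<close>

definition trivial_link :: "nat \<Rightarrow> curve list" where
  "trivial_link n = map (\<lambda>j t. (rcis (real j) (2 * pi * t), real j)) [1..<Suc n]"

text \<open>
  Closed braids around the vertical axis.  In each half-plane through the axis, with coordinates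
  \<open>(r, z)\<close>, the strands rest at \<open>(1, 0), \<dots>, (n, 0)\<close>.  \<open>strand (i, b) j s\<close> is the position at time
  \<open>s \<in> [0, 1]\<close> of the strand starting at \<open>(j, 0)\<close> while the letter \<open>(i, b)\<close> is performed: the strands
  at \<open>i\<close> and \<open>i + 1\<close> make a half turn about their midpoint.  The strands run counterclockwise as
  seen from above, so the crossing seen from above is positive iff the strand moving outwards
  (from \<open>i\<close> to \<open>i + 1\<close>) passes over (\<open>z > 0\<close>).
\<close>

fun strand :: "letter \<Rightarrow> nat \<Rightarrow> real \<Rightarrow> real \<times> real" where
  "strand (i, b) j s =
     (let e = (if b then 1 else - 1) in
      if j = i then (real i + 1 / 2 - cos (pi * s) / 2, e * sin (pi * s) / 2)
      else if j = i + 1 then (real i + 1 / 2 + cos (pi * s) / 2, - e * sin (pi * s) / 2)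
      else (real j, 0))"

text \<open>
  The full turn is divided into \<open>length w + 1\<close> equal sectors, one for each letter and a last
  one in which all strands rest (so that the empty word needs no special treatment).
\<close>

definition closed_braid :: "nat \<Rightarrow> letter list \<Rightarrow> space set" where
  "closed_braid n w =
     {(rcis r (2 * pi * (real p + s) / (real (length w) + 1)), z) | r z p j s.
        p \<le> length w \<and> j \<in> {1..n} \<and> s \<in> {0..1} \<and>
        (r, z) = (if p < length w then strand (w ! p) j s else (real j, 0))}"

definition is_braid_closure :: "nat \<Rightarrow> letter list \<Rightarrow> curve list \<Rightarrow> bool" where
  "is_braid_closure n w L \<longleftrightarrow>
     oriented_link L \<and> (\<Union>\<gamma>\<in>set L. path_image \<gamma>) = closed_braid n w \<and>
     (\<forall>\<gamma>\<in>set L. \<exists>\<phi>. continuous_on {0..1} \<phi> \<and> strict_mono_on {0..1} \<phi> \<and>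
        (\<forall>t\<in>{0..1}. fst (\<gamma> t) = rcis (cmod (fst (\<gamma> t))) (\<phi> t)))"

definition closure_isotopic_to :: "nat \<Rightarrow> letter list set \<Rightarrow> curve list \<Rightarrow> bool" where
  "closure_isotopic_to n \<xi> L \<longleftrightarrow> (\<exists>w\<in>\<xi>. \<exists>K. is_braid_closure n w K \<and> link_isotopic K L)"

text \<open>Conjugation and (de)stabilization.\<close>

inductive markov_equiv :: "nat \<Rightarrow> letter list set \<Rightarrow> nat \<Rightarrow> letter list set \<Rightarrow> bool" where
  refl: "1 \<le> n \<Longrightarrow> \<xi> \<in> carrier (braid_group n) \<Longrightarrow> markov_equiv n \<xi> n \<xi>"
| sym: "markov_equiv n \<xi> n' \<xi>' \<Longrightarrow> markov_equiv n' \<xi>' n \<xi>"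
| trans: "markov_equiv n \<xi> n' \<xi>' \<Longrightarrow> markov_equiv n' \<xi>' n'' \<xi>'' \<Longrightarrow> markov_equiv n \<xi> n'' \<xi>''"
| conjugation: "1 \<le> n \<Longrightarrow> \<xi> \<in> carrier (braid_group n) \<Longrightarrow> \<eta> \<in> carrier (braid_group n) \<Longrightarrow>
    markov_equiv n \<xi> n
      (\<eta> \<otimes>\<^bsub>braid_group n\<^esub> \<xi> \<otimes>\<^bsub>braid_group n\<^esub> inv\<^bsub>braid_group n\<^esub> \<eta>)"
| stabilization: "1 \<le> n \<Longrightarrow> w \<in> braid_words n \<Longrightarrow>
    markov_equiv n (braid_class n w) (Suc n) (braid_class (Suc n) (w @ [(n, b)]))"

text \<open>
  The assertion of Markov's theorem (the classical result that \<open>braid_link_invariant\<close> below depends on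
  for being well defined): braids with isotopic closures are related by Markov moves.
\<close>

definition markov_theorem :: bool where
  "markov_theorem \<longleftrightarrow>
     (\<forall>L n \<xi> n' \<xi>'. 1 \<le> n \<longrightarrow> 1 \<le> n' \<longrightarrow>
        \<xi> \<in> carrier (braid_group n) \<longrightarrow> \<xi>' \<in> carrier (braid_group n') \<longrightarrow>
        closure_isotopic_to n \<xi> L \<longrightarrow> closure_isotopic_to n' \<xi>' L \<longrightarrow>
        markov_equiv n \<xi> n' \<xi>')"

definition braid_link_invariant ::
  "nat \<Rightarrow> nat \<Rightarrow> nat \<Rightarrow> complex mat \<Rightarrow> complex mat \<Rightarrow> complex \<Rightarrow> complex \<Rightarrow> curve list \<Rightarrow> complex" where
  "braid_link_invariant d k m R \<mu> \<alpha> \<beta> L =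
     (THE c. \<exists>n\<ge>1. \<exists>\<xi>\<in>carrier (braid_group n).
        closure_isotopic_to n \<xi> L \<and> c = braid_invariant d k m R \<mu> \<alpha> \<beta> n \<xi>)"


section \<open>The operator of type II\<close>

definition R_typeII :: "real \<Rightarrow> complex mat" where
  "R_typeII \<theta> = diag_block_mat
     [complex_of_real (1 / sqrt 2) \<cdot>\<^sub>m mat_of_rows_list 4
        [[1, 0, 1, 0],
         [0, \<i>, 0, cis \<theta>],
         [-1, 0, 1, 0],
         [0, cis (- \<theta>), 0, \<i>]],
      complex_of_real (1 / sqrt 2) \<cdot>\<^sub>m mat_of_rows_list 4
        [[\<i>, 0, cis \<theta>, 0],
         [0, 1, 0, - cis (2 * \<theta>)],
         [cis (- \<theta>), 0, \<i>, 0],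
         [0, cis (- (2 * \<theta>)), 0, 1]]]"

end

theory Submission
  imports Defs
begin

text \<open>
  The basis vectors of a tensor power of \<open>V\<close> are bit strings.  In this basis \<open>R(\<theta>)\<close> changes only
  the middle one of three consecutive bits, by a matrix of size two that depends on its neighbours;
  so it is an operator of a face model, with the bits as heights.  All its properties follow from
  this description.

  The Yang--Baxter equation becomes the star-triangle relation for the face weights
  (\<open>face_weight_star_triangle\<close>), an identity between sums of two products, which is checked for each
  choice of the boundary heights.  Far commutativity holds because neither of two distant
  operators changes a bit that the other uses (\<open>R_typeII_far\<close>).

  For the enhancement, no generator can change the last bit of a string, so all operators in
  the image of \<open>B\<^sub>n\<close> are block diagonal with respect to it.  The partial trace of \<open>R\<close> over its third
  factor has the constant diagonal \<open>(1 + \<i>)/\<surd>2 = \<alpha>\<close>, and its other nonzero entries flip the second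
  bit, the last one that remains (\<open>flips_last_bit_partial_trace_R_typeII\<close>).  Operators that preserve
  and operators that flip the last bit are perpendicular, which is the condition on
  the enhancement; the inverse of \<open>R\<close> is treated by taking adjoints, as \<open>R\<close> is unitary.

  That an enhanced operator gives a Markov invariant is shown for every unitary one, in any type
  \<open>(d, k, m)\<close> and for any \<open>\<mu>\<close>.  Conjugation does not matter because the trace is cyclic and \<open>\<mu>\<close>
  commutes with \<open>R\<close>.  For stabilization the last strand is traced out, which puts the partial trace
  of \<open>R\<close> in the place of the last generator; perpendicularity replaces it by a multiple of a power
  of \<open>\<mu>\<close>, and the normalization absorbs the factor (\<open>word_trace_stabilize\<close>).  Unitarity is used
  because perpendicularity involves the adjoints of represented braids, which here are again
  represented braids.

  Finally, the closure of the trivial braid on \<open>n\<close> strands consists of concentric plane circles,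
  which a shear along the axis moves into the components of the trivial link.  The invariant of this
  braid is the trace of the identity of the \<open>(n + 1)\<close>-st tensor power of \<open>V\<close>, namely
  \<open>2 ^ (n + 1)\<close>.
\<close>

section \<open>Kronecker products, adjoints and partial traces\<close>

lemma dim_kron [simp]:
  "dim_row (kron A B) = dim_row A * dim_row B"
  "dim_col (kron A B) = dim_col A * dim_col B"
  by (simp_all add: kron_def)

lemma kron_carrier:
  assumes "A \<in> carrier_mat a b" "B \<in> carrier_mat c d"
  shows "kron A B \<in> carrier_mat (a * c) (b * d)"
  using assms by (intro carrier_matI) auto

lemma index_kron:
  assumes "A \<in> carrier_mat a b" "B \<in> carrier_mat c d" "i < a * c" "j < b * d"
  shows "kron A B $$ (i, j) = A $$ (i div c, j div d) * B $$ (i mod c, j mod d)"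
  using assms by (auto simp: kron_def)

lemma div_less_of_less_mult: "i div c < a" if "i < a * c" for a c i :: nat
  using that by (simp add: less_mult_imp_div_less)

lemma mod_less_of_less_mult: "i mod c < c" if "i < a * c" for a c i :: nat
  using that by (cases "c = 0") auto

lemma mult_add_less: "x * q + y < p * q" if "x < p" "y < q" for x y p q :: nat
proof -
  have "x * q + y < x * q + q" using that by simp
  also have "\<dots> = Suc x * q" by simp
  also have "\<dots> \<le> p * q" using that by (intro mult_le_mono1) simp
  finally show ?thesis .
qed

lemma div_mod_mult_add:
  fixes x y p q :: nat
  assumes "y < q"
  shows "(x * q + y) div (p * q) = x div p" "(x * q + y) mod (p * q) = (x mod p) * q + y"
proof -
  have "(x * q + y) div q = x" "(x * q + y) mod q = y" using assms by auto
  then show "(x * q + y) div (p * q) = x div p" "(x * q + y) mod (p * q) = (x mod p) * q + y"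
    by (metis div_mult2_eq mult.commute, metis mod_mult2_eq mult.commute)
qed

lemma sum_lessThan_mult:
  fixes f :: "nat \<Rightarrow> 'a::comm_monoid_add"
  shows "(\<Sum>k<p * q. f k) = (\<Sum>x<p. \<Sum>y<q. f (x * q + y))"
proof -
  have "(\<Sum>k<p * q. f k) = (\<Sum>(x, y)\<in>{..<p} \<times> {..<q}. f (x * q + y))"
    by (rule sum.reindex_bij_witness[where i = "\<lambda>(x, y). x * q + y" and j = "\<lambda>k. (k div q, k mod q)"])
      (auto simp: mult_add_less div_less_of_less_mult mod_less_of_less_mult)
  then show ?thesis by (simp add: sum.cartesian_product)
qed

lemma index_mult_mat_sum:
  assumes "A \<in> carrier_mat a b" "B \<in> carrier_mat b c" "i < a" "j < c"
  shows "(A * B) $$ (i, j) = (\<Sum>k<b. A $$ (i, k) * B $$ (k, j))"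
  using assms by (auto simp: scalar_prod_def atLeast0LessThan intro!: sum.cong)

text \<open>
  The row and column indices of a Kronecker product are pairs written in a mixed radix, so the sum
  over the inner index factors into the sums that define the two products.
\<close>

lemma kron_mult:
  assumes "A \<in> carrier_mat a b" "B \<in> carrier_mat c d" "C \<in> carrier_mat b e" "D \<in> carrier_mat d f"
  shows "kron A B * kron C D = kron (A * C) (B * D)"
proof (rule eq_matI)
  fix i j assume ij: "i < dim_row (kron (A * C) (B * D))" "j < dim_col (kron (A * C) (B * D))"
  then have i: "i < a * c" and j: "j < e * f" using assms by auto
  have dm: "i div c < a" "j div f < e" "i mod c < c" "j mod f < f"
    using i j by (auto simp: div_less_of_less_mult mod_less_of_less_mult)
  have "(kron A B * kron C D) $$ (i, j) = (\<Sum>k<b * d. kron A B $$ (i, k) * kron C D $$ (k, j))"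
    by (rule index_mult_mat_sum[OF kron_carrier[OF assms(1,2)] kron_carrier[OF assms(3,4)] i j])
  also have "\<dots> = (\<Sum>x<b. \<Sum>y<d. kron A B $$ (i, x * d + y) * kron C D $$ (x * d + y, j))"
    by (rule sum_lessThan_mult)
  also have "\<dots> = (\<Sum>x<b. \<Sum>y<d. (A $$ (i div c, x) * C $$ (x, j div f)) *
                                  (B $$ (i mod c, y) * D $$ (y, j mod f)))"
    by (intro sum.cong[OF HOL.refl]) (simp add: index_kron[OF assms(1,2)] index_kron[OF assms(3,4)] i
      j mult_add_less)
  also have "\<dots> = (A * C) $$ (i div c, j div f) * (B * D) $$ (i mod c, j mod f)"
    by (simp add: index_mult_mat_sum[OF assms(1,3)] index_mult_mat_sum[OF assms(2,4)] dm
        sum_product del: index_mult_mat)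
  also have "\<dots> = kron (A * C) (B * D) $$ (i, j)"
    by (rule index_kron[symmetric]) (use assms i j in auto)
  finally show "(kron A B * kron C D) $$ (i, j) = kron (A * C) (B * D) $$ (i, j)" .
qed (use assms in auto)

lemma div_mod_mult:
  fixes i b c :: nat
  shows "i div (b * c) = i div c div b" "i mod (b * c) div c = i div c mod b" "i mod (b * c) mod c =
    i mod c"
proof -
  show "i div (b * c) = i div c div b" by (metis div_mult2_eq mult.commute)
  have *: "i mod (b * c) = c * (i div c mod b) + i mod c" by (metis mod_mult2_eq mult.commute)
  show "i mod (b * c) div c = i div c mod b"
  proof (cases "c = 0")
    case False
    then show ?thesis unfolding * by simp
  qed simp
  show "i mod (b * c) mod c = i mod c" unfolding * by simp
qed

text \<open>
  Both sides read off the same three digits of an index in the mixed radix given by the three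
  dimensions.
\<close>

lemma kron_assoc: "kron (kron A B) C = kron A (kron B C)"
proof (rule eq_matI)
  fix i j assume ij: "i < dim_row (kron A (kron B C))" "j < dim_col (kron A (kron B C))"
  have carr: "A \<in> carrier_mat (dim_row A) (dim_col A)" "B \<in> carrier_mat (dim_row B) (dim_col B)"
    "C \<in> carrier_mat (dim_row C) (dim_col C)" by auto
  have i: "i < dim_row A * (dim_row B * dim_row C)" and j: "j < dim_col A * (dim_col B * dim_col C)"
    using ij by auto
  then have i2: "i < dim_row A * dim_row B * dim_row C" and j2: "j < dim_col A * dim_col B * dim_col C"
    by (simp_all only: mult.assoc)
  have "kron (kron A B) C $$ (i, j) = kron A B $$ (i div dim_row C, j div dim_col C)
      * C $$ (i mod dim_row C, j mod dim_col C)"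
    by (rule index_kron[OF kron_carrier[OF carr(1,2)] carr(3) i2 j2])
  also have "kron A B $$ (i div dim_row C, j div dim_col C) =
      A $$ (i div dim_row C div dim_row B, j div dim_col C div dim_col B)
      * B $$ (i div dim_row C mod dim_row B, j div dim_col C mod dim_col B)"
    by (rule index_kron[OF carr(1,2) div_less_of_less_mult[OF i2] div_less_of_less_mult[OF j2]])
  finally have lhs: "kron (kron A B) C $$ (i, j) =
      A $$ (i div (dim_row B * dim_row C), j div (dim_col B * dim_col C))
      * (B $$ (i mod (dim_row B * dim_row C) div dim_row C, j mod (dim_col B * dim_col C) div dim_col C)
      * C $$ (i mod (dim_row B * dim_row C) mod dim_row C, j mod (dim_col B * dim_col C) mod dim_col
        C))"
    by (simp only: div_mod_mult mult.assoc)
  have "kron B C $$ (i mod (dim_row B * dim_row C), j mod (dim_col B * dim_col C)) =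
      B $$ (i mod (dim_row B * dim_row C) div dim_row C, j mod (dim_col B * dim_col C) div dim_col C)
      * C $$ (i mod (dim_row B * dim_row C) mod dim_row C, j mod (dim_col B * dim_col C) mod dim_col C)"
    by (rule index_kron[OF carr(2,3) mod_less_of_less_mult[OF i] mod_less_of_less_mult[OF j]])
  then show "kron (kron A B) C $$ (i, j) = kron A (kron B C) $$ (i, j)"
    unfolding lhs index_kron[OF carr(1) kron_carrier[OF carr(2,3)] i j] by (simp only:)
qed (auto simp: mult.assoc)

lemma kron_one_left [simp]: "kron (1\<^sub>m 1) A = A"
  by (rule eq_matI) (auto simp: kron_def)

lemma kron_one_right [simp]: "kron A (1\<^sub>m 1) = A"
  by (rule eq_matI) (auto simp: kron_def)

lemma kron_one_one [simp]: "kron (1\<^sub>m a) (1\<^sub>m b) = 1\<^sub>m (a * b)"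
proof (rule eq_matI)
  fix i j assume "i < dim_row (1\<^sub>m (a * b) :: complex mat)" "j < dim_col (1\<^sub>m (a * b) :: complex mat)"
  then have ij: "i < a * b" "j < a * b" by auto
  have "i = j \<longleftrightarrow> i div b = j div b \<and> i mod b = j mod b"
    by (metis div_mult_mod_eq)
  then show "kron (1\<^sub>m a) (1\<^sub>m b) $$ (i, j) = (1\<^sub>m (a * b) :: complex mat) $$ (i, j)"
    using ij by (auto simp: index_kron[of _ a a _ b b] div_less_of_less_mult mod_less_of_less_mult)
qed auto

lemma kron_minus_right:
  assumes "A \<in> carrier_mat a b" "B \<in> carrier_mat c d" "C \<in> carrier_mat c d"
  shows "kron A (B - C) = kron A B - kron A C"
proof (rule eq_matI)
  fix i j assume "i < dim_row (kron A B - kron A C)" "j < dim_col (kron A B - kron A C)"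
  then have ij: "i < a * c" "j < b * d" using assms by auto
  have "(B - C) $$ (i mod c, j mod d) = B $$ (i mod c, j mod d) - C $$ (i mod c, j mod d)"
    using assms(3) mod_less_of_less_mult[OF ij(1)] mod_less_of_less_mult[OF ij(2)] by simp
  moreover have "dim_row (kron A C) = a * c" "dim_col (kron A C) = b * d" using assms by auto
  ultimately show "kron A (B - C) $$ (i, j) = (kron A B - kron A C) $$ (i, j)"
    using ij by (simp add: index_kron[OF assms(1,2)] index_kron[OF assms(1,3)]
        index_kron[OF assms(1) minus_carrier_mat[OF assms(3)]] right_diff_distrib del: dim_kron)
qed (use assms in auto)

lemma kron_smult_right: "kron A (x \<cdot>\<^sub>m B) = x \<cdot>\<^sub>m kron A B"
  by (intro eq_matI) (auto simp: kron_def mod_less_of_less_mult div_less_of_less_mult)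

lemma kron_pow_carrier: "A \<in> carrier_mat d d \<Longrightarrow> kron_pow A k \<in> carrier_mat (d ^ k) (d ^ k)"
  by (induction k) (auto intro: kron_carrier)

lemma kron_pow_add: "kron_pow A (a + b) = kron (kron_pow A a) (kron_pow A b)"
  by (induction a) (simp_all add: kron_assoc kron_one_left[unfolded One_nat_def])

lemma kron_pow_one [simp]: "kron_pow (1\<^sub>m d) k = 1\<^sub>m (d ^ k)"
  by (induction k) simp_all

lemma dim_mat_adjoint [simp]:
  "dim_row (mat_adjoint A) = dim_col A" "dim_col (mat_adjoint A) = dim_row A"
  by (simp_all add: mat_adjoint_def)

lemma mat_adjoint_carrier: "A \<in> carrier_mat a b \<Longrightarrow> mat_adjoint A \<in> carrier_mat b a"
  by (intro carrier_matI) auto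

lemma index_mat_adjoint:
  "A \<in> carrier_mat a b \<Longrightarrow> i < b \<Longrightarrow> j < a \<Longrightarrow> mat_adjoint A $$ (i, j) = cnj (A $$ (j, i))"
  for A :: "complex mat"
  by (simp add: mat_adjoint_def mat_of_rows_def)

lemma mat_adjoint_mat_adjoint [simp]: "mat_adjoint (mat_adjoint A) = A" for A :: "complex mat"
proof (rule eq_matI)
  have A: "A \<in> carrier_mat (dim_row A) (dim_col A)" by auto
  fix i j assume "i < dim_row A" "j < dim_col A"
  then show "mat_adjoint (mat_adjoint A) $$ (i, j) = A $$ (i, j)"
    by (simp add: index_mat_adjoint[OF A] index_mat_adjoint[OF mat_adjoint_carrier[OF A]])
qed auto

lemma mat_adjoint_one [simp]: "mat_adjoint (1\<^sub>m n) = (1\<^sub>m n :: complex mat)"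
  by (rule eq_matI) (auto simp: index_mat_adjoint[of _ n n])

lemma mat_adjoint_mult:
  assumes "A \<in> carrier_mat a b" "B \<in> carrier_mat b c"
  shows "mat_adjoint (A * B) = mat_adjoint B * mat_adjoint (A :: complex mat)"
proof (rule eq_matI)
  fix i j assume ij: "i < dim_row (mat_adjoint B * mat_adjoint A)" "j < dim_col (mat_adjoint B *
    mat_adjoint A)"
  then have i: "i < c" and j: "j < a" using assms by auto
  have "(mat_adjoint B * mat_adjoint A) $$ (i, j) = (\<Sum>k<b. mat_adjoint B $$ (i,
    k) * mat_adjoint A $$ (k, j))"
    by (rule index_mult_mat_sum[OF mat_adjoint_carrier mat_adjoint_carrier]) (use assms i j in auto)
  also have "\<dots> = cnj (\<Sum>k<b. A $$ (j, k) * B $$ (k, i))"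
    using i j by (simp add: index_mat_adjoint[OF assms(1)] index_mat_adjoint[OF assms(2)] mult.commute)
  also have "\<dots> = mat_adjoint (A * B) $$ (i, j)"
    using assms i j by (simp add: index_mat_adjoint[of _ a c] index_mult_mat_sum[OF assms] del:
      index_mult_mat)
  finally show "mat_adjoint (A * B) $$ (i, j) = (mat_adjoint B * mat_adjoint A) $$ (i, j)" by simp
qed (use assms in auto)

lemma mat_adjoint_kron:
  assumes A: "A \<in> carrier_mat a b" and B: "B \<in> carrier_mat c d"
  shows "mat_adjoint (kron A B) = kron (mat_adjoint A) (mat_adjoint B)"
proof (rule eq_matI)
  fix i j assume "i < dim_row (kron (mat_adjoint A) (mat_adjoint B))" "j < dim_col (kron (mat_adjoint
    A) (mat_adjoint B))"
  then have "i < b * d" "j < a * c" using A B by auto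
  then show "mat_adjoint (kron A B) $$ (i, j) = kron (mat_adjoint A) (mat_adjoint B) $$ (i, j)"
    by (simp add: index_mat_adjoint[OF kron_carrier[OF A B]] index_kron[OF A B]
        index_kron[OF mat_adjoint_carrier[OF A] mat_adjoint_carrier[OF B]]
        index_mat_adjoint[OF A] index_mat_adjoint[OF B] div_less_of_less_mult mod_less_of_less_mult)
qed auto

lemma mat_inv_eqI:
  assumes A: "A \<in> carrier_mat n n" and B: "B \<in> carrier_mat n n" and AB: "A * B = 1\<^sub>m n"
  shows "mat_inv A = B"
proof -
  have BA: "B * A = 1\<^sub>m n"
    by (rule mat_mult_left_right_inverse[OF A B AB])
  have "A \<in> Units (ring_mat TYPE(complex) n ())"
    using A B AB BA by (auto simp: Units_def ring_mat_def)
  then obtain C where C: "mat_inverse A = Some C"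
    using mat_inverse(1)[OF A, of "()"] by (cases "mat_inverse A") auto
  with mat_inverse(2)[OF A] have "C * A = 1\<^sub>m n" "C \<in> carrier_mat n n" by auto
  then have "C = B"
    by (metis A AB B assoc_mult_mat left_mult_one_mat right_mult_one_mat)
  then show ?thesis using C by (simp add: mat_inv_def)
qed

lemma mat_trace_mult:
  assumes "A \<in> carrier_mat a b" "B \<in> carrier_mat b a"
  shows "mat_trace (A * B) = (\<Sum>i<a. \<Sum>j<b. A $$ (i, j) * B $$ (j, i))"
  using assms by (simp add: mat_trace_def index_mult_mat_sum[OF assms] del: index_mult_mat(1))

lemma mat_trace_mult_commute:
  assumes "A \<in> carrier_mat a b" "B \<in> carrier_mat b a"
  shows "mat_trace (A * B) = mat_trace (B * A)"
  unfolding mat_trace_mult[OF assms] mat_trace_mult[OF assms(2,1)]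
  by (subst sum.swap) (simp add: mult.commute)

lemma mat_trace_minus:
  "A \<in> carrier_mat n n \<Longrightarrow> B \<in> carrier_mat n n \<Longrightarrow> mat_trace (A - B) = mat_trace A - mat_trace B"
  by (auto simp: mat_trace_def sum_subtractf)

lemma mat_trace_smult: "A \<in> carrier_mat n n \<Longrightarrow> mat_trace (x \<cdot>\<^sub>m A) = x * mat_trace A"
  by (auto simp: mat_trace_def sum_distrib_left)

lemma mat_trace_one [simp]: "mat_trace (1\<^sub>m n) = of_nat n"
  by (simp add: mat_trace_def)

lemma partial_trace_carrier: "partial_trace d k m X \<in> carrier_mat (d ^ (k - m)) (d ^ (k - m))"
  by (simp add: partial_trace_def)

text \<open>
  The defining property of the partial trace: it is adjoint to tensoring with the identity with
  respect to the trace pairing.  This turns a trace over \<open>n + 1\<close> strands into one over \<open>n\<close> strands.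
\<close>

lemma mat_trace_kron_one_mult:
  assumes "m \<le> k" "A \<in> carrier_mat (d ^ (k - m)) (d ^ (k - m))" "X \<in> carrier_mat (d ^ k) (d ^ k)"
  shows "mat_trace (kron A (1\<^sub>m (d ^ m)) * X) = mat_trace (A * partial_trace d k m X)"
proof -
  let ?p = "d ^ (k - m)" and ?q = "d ^ m"
  have k: "d ^ k = ?p * ?q" using assms(1) by (simp flip: power_add)
  have carr: "kron A (1\<^sub>m ?q) \<in> carrier_mat (?p * ?q) (?p * ?q)"
    using kron_carrier[OF assms(2), of "1\<^sub>m ?q" ?q ?q] by simp
  have "mat_trace (kron A (1\<^sub>m ?q) * X) =
      (\<Sum>x<?p. \<Sum>y<?q. \<Sum>z<?p. \<Sum>t<?q. kron A (1\<^sub>m ?q) $$ (x * ?q + y, z * ?q + t) * X $$ (z * ?q + t,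
        x * ?q + y))"
    using assms(3) unfolding k by (simp only: mat_trace_mult[OF carr] sum_lessThan_mult)
  also have "\<dots> = (\<Sum>x<?p. \<Sum>y<?q. \<Sum>z<?p. \<Sum>t<?q. (if t = y then A $$ (x, z) * X $$ (z * ?q + t,
    x * ?q + y) else 0))"
    by (intro sum.cong[OF HOL.refl]) (auto simp: index_kron[OF assms(2), of
      "1\<^sub>m ?q" ?q ?q] mult_add_less
          div_mod_mult_add(1)[of _ ?q _ 1, simplified])
  also have "\<dots> = (\<Sum>x<?p. \<Sum>y<?q. \<Sum>z<?p. A $$ (x, z) * X $$ (z * ?q + y, x * ?q + y))"
    by simp
  also have "\<dots> = (\<Sum>x<?p. \<Sum>z<?p. \<Sum>y<?q. A $$ (x, z) * X $$ (z * ?q + y, x * ?q + y))"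
    by (intro sum.cong[OF HOL.refl] sum.swap)
  also have "\<dots> = mat_trace (A * partial_trace d k m X)"
    unfolding mat_trace_mult[OF assms(2) partial_trace_carrier]
    by (intro sum.cong[OF HOL.refl]) (simp add: partial_trace_def sum_distrib_left)
  finally show ?thesis .
qed

text \<open>
  Factors to the left are not touched by the summation over the last indices, so the partial trace
  of an operator on the last \<open>k\<close> factors can be computed inside these \<open>k\<close> factors.
\<close>

lemma partial_trace_kron:
  assumes "m \<le> k" "Y \<in> carrier_mat (d ^ a) (d ^ a)" "X \<in> carrier_mat (d ^ k) (d ^ k)"
  shows "partial_trace d (a + k) m (kron Y X) = kron Y (partial_trace d k m X)"
proof (rule eq_matI)
  let ?p = "d ^ (k - m)" and ?q = "d ^ m"
  have k: "d ^ k = ?p * ?q" using assms(1) by (simp flip: power_add)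
  have ak: "d ^ (a + k - m) = d ^ a * ?p" using assms(1) by (simp flip: power_add)
  fix i j assume "i < dim_row (kron Y (partial_trace d k m X))" "j < dim_col (kron Y (partial_trace d
    k m X))"
  then have ij: "i < d ^ a * ?p" "j < d ^ a * ?p" using assms(2) by (auto simp: partial_trace_def)
  have *: "(x * ?q + y) div (?p * ?q) = x div ?p" "(x * ?q + y) mod (?p * ?q) = (x mod ?p) * ?q + y"
    if "y < ?q" for x y
    using div_mod_mult_add[OF that] by blast+
  have "partial_trace d (a + k) m (kron Y X) $$ (i, j) = (\<Sum>l<?q. kron Y X $$ (i * ?q + l, j * ?q + l))"
    using ij by (simp add: partial_trace_def ak)
  also have "\<dots> = (\<Sum>l<?q. Y $$ (i div ?p, j div ?p) * X $$ ((i mod ?p) * ?q + l, (j mod ?p) * ?q + l))"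
  proof (intro sum.cong[OF HOL.refl])
    fix l assume "l \<in> {..<?q}"
    then have l: "l < ?q" by simp
    have "i * ?q + l < d ^ a * (?p * ?q)" "j * ?q + l < d ^ a * (?p * ?q)"
      using mult_add_less[OF ij(1) l] mult_add_less[OF ij(2) l] by (simp_all add: mult.assoc)
    then show "kron Y X $$ (i * ?q + l, j * ?q + l) =
        Y $$ (i div ?p, j div ?p) * X $$ ((i mod ?p) * ?q + l, (j mod ?p) * ?q + l)"
      using assms(3) unfolding k by (simp add: index_kron[OF assms(2)] *[OF l])
  qed
  also have "\<dots> = kron Y (partial_trace d k m X) $$ (i, j)"
    unfolding index_kron[OF assms(2) partial_trace_carrier ij]
    using mod_less_of_less_mult[OF ij(1)] mod_less_of_less_mult[OF ij(2)]
    by (simp add: partial_trace_def sum_distrib_left)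
  finally show "partial_trace d (a + k) m (kron Y X) $$ (i, j) = kron Y (partial_trace d k m X) $$
    (i, j)" .
qed (use assms in \<open>auto simp: partial_trace_def simp flip: power_add\<close>)

section \<open>The braid group as a group of words\<close>

lemma braid_words_simps [simp]:
  "[] \<in> braid_words n"
  "(i, b) # w \<in> braid_words n \<longleftrightarrow> 1 \<le> i \<and> i < n \<and> w \<in> braid_words n"
  "u @ v \<in> braid_words n \<longleftrightarrow> u \<in> braid_words n \<and> v \<in> braid_words n"
  by (auto simp: braid_words_def)

lemma braid_words_mono: "w \<in> braid_words n \<Longrightarrow> n \<le> n' \<Longrightarrow> w \<in> braid_words n'"
  by (force simp: braid_words_def)

lemma braid_rel_words: "(u, v) \<in> braid_rel n \<Longrightarrow> u \<in> braid_words n \<and> v \<in> braid_words n"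
  by (induction rule: braid_rel.induct) auto

text \<open>
  The defining relations may be applied inside any context, so the relation generated by them is a
  congruence; concatenation is then well defined on classes.
\<close>

lemma braid_rel_append_left:
  "(u, v) \<in> braid_rel n \<Longrightarrow> x \<in> braid_words n \<Longrightarrow> (x @ u, x @ v) \<in> braid_rel n"
proof (induction rule: braid_rel.induct)
  case (cancel u v i b)
  then show ?case using braid_rel.cancel[of "x @ u" n v i b] by simp
next
  case (far u v i j)
  then show ?case using braid_rel.far[of "x @ u" n v i j] by simp
next
  case (braid u v i)
  then show ?case using braid_rel.braid[of "x @ u" n v i] by simp
qed (auto intro: braid_rel.refl braid_rel.sym braid_rel.trans)

lemma braid_rel_append_right:
  "(u, v) \<in> braid_rel n \<Longrightarrow> x \<in> braid_words n \<Longrightarrow> (u @ x, v @ x) \<in> braid_rel n"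
proof (induction rule: braid_rel.induct)
  case (cancel u v i b)
  then show ?case using braid_rel.cancel[of u n "v @ x" i b] by simp
next
  case (far u v i j)
  then show ?case using braid_rel.far[of u n "v @ x" i j] by simp
next
  case (braid u v i)
  then show ?case using braid_rel.braid[of u n "v @ x" i] by simp
qed (auto intro: braid_rel.refl braid_rel.sym braid_rel.trans)

lemma braid_rel_append:
  assumes "(u, u') \<in> braid_rel n" "(v, v') \<in> braid_rel n"
  shows "(u @ v, u' @ v') \<in> braid_rel n"
  using braid_rel.trans[OF braid_rel_append_right[OF assms(1)] braid_rel_append_left[OF assms(2)]]
    braid_rel_words[OF assms(1)] braid_rel_words[OF assms(2)] by blast

lemma equiv_braid_rel: "equiv (braid_words n) (braid_rel n)"
proof (rule equivI)
  show "braid_rel n \<subseteq> braid_words n \<times> braid_words n" using braid_rel_words by auto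
  show "refl_on (braid_words n) (braid_rel n)" by (auto simp: refl_on_def intro: braid_rel.refl)
  show "sym (braid_rel n)" by (auto simp: sym_def intro: braid_rel.sym)
  show "trans (braid_rel n)" by (auto simp: trans_def intro: braid_rel.trans)
qed

lemma braid_class_eq_iff:
  "u \<in> braid_words n \<Longrightarrow> v \<in> braid_words n \<Longrightarrow>
    braid_class n u = braid_class n v \<longleftrightarrow> (u, v) \<in> braid_rel n"
  unfolding braid_class_def using eq_equiv_class_iff[OF equiv_braid_rel] by blast

lemma mem_braid_class: "w \<in> braid_words n \<Longrightarrow> w \<in> braid_class n w"
  by (auto simp: braid_class_def intro: braid_rel.refl)

lemma braid_class_carrier: "w \<in> braid_words n \<Longrightarrow> braid_class n w \<in> carrier (braid_group n)"
  by (auto simp: braid_group_def braid_class_def intro: quotientI)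

lemma braid_group_carrierE:
  assumes "\<xi> \<in> carrier (braid_group n)"
  obtains w where "w \<in> braid_words n" "\<xi> = braid_class n w"
  using assms by (auto simp: braid_group_def braid_class_def elim: quotientE)

lemma braid_class_mult:
  assumes "u \<in> braid_words n" "v \<in> braid_words n"
  shows "braid_class n u \<otimes>\<^bsub>braid_group n\<^esub> braid_class n v = braid_class n (u @ v)"
proof -
  have "braid_class n (x @ y) = braid_class n (u @ v)"
    if "x \<in> braid_class n u" "y \<in> braid_class n v" for x y
  proof -
    have *: "(u, x) \<in> braid_rel n" "(v, y) \<in> braid_rel n" using that by (auto simp: braid_class_def)
    show ?thesis
      using braid_rel_append[OF *] braid_rel_words[OF *(1)] braid_rel_words[OF *(2)]
      by (intro braid_class_eq_iff[THEN iffD2]) (auto intro: braid_rel.sym)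
  qed
  then have "(\<Union>x\<in>braid_class n u. \<Union>y\<in>braid_class n v. braid_class n (x @ y)) = braid_class n (u @ v)"
    using mem_braid_class[OF assms(1)] mem_braid_class[OF assms(2)] by blast
  then show ?thesis by (simp only: braid_group_def monoid.simps)
qed

definition inv_word :: "letter list \<Rightarrow> letter list" where
  "inv_word w = rev (map (\<lambda>(i, b). (i, \<not> b)) w)"

lemma inv_word_simps [simp]:
  "inv_word [] = []" "inv_word ((i, b) # w) = inv_word w @ [(i, \<not> b)]"
  by (simp_all add: inv_word_def)

lemma inv_word_braid_words [simp]: "inv_word w \<in> braid_words n \<longleftrightarrow> w \<in> braid_words n"
  by (induction w) auto

lemma inv_word_append: "inv_word (u @ v) = inv_word v @ inv_word u"
  by (simp add: inv_word_def)

lemma inv_word_inv_word [simp]: "inv_word (inv_word w) = w"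
  by (induction w) (auto simp: inv_word_append)

lemma append_inv_word_rel: "w \<in> braid_words n \<Longrightarrow> (w @ inv_word w, []) \<in> braid_rel n"
proof (induction w)
  case (Cons l w)
  obtain i b where l: "l = (i, b)" by (cases l)
  have w: "w \<in> braid_words n" "1 \<le> i" "i < n" using Cons.prems l by auto
  have "([(i, b)] @ (w @ inv_word w) @ [(i, \<not> b)], [(i, b)] @ [] @ [(i, \<not> b)]) \<in> braid_rel n"
    using Cons.IH w by (intro braid_rel_append braid_rel.refl) auto
  moreover have "([] @ [(i, b), (i, \<not> b)] @ [], [] @ []) \<in> braid_rel n"
    using w by (intro braid_rel.cancel) auto
  ultimately show ?case unfolding l by (auto intro: braid_rel.trans)
qed (auto intro: braid_rel.refl)

lemma inv_word_append_rel: "w \<in> braid_words n \<Longrightarrow> (inv_word w @ w, []) \<in> braid_rel n"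
  using append_inv_word_rel[of "inv_word w" n] by simp

lemma one_braid_group: "\<one>\<^bsub>braid_group n\<^esub> = braid_class n []"
  by (simp add: braid_group_def)

lemma group_braid_group: "group (braid_group n)"
proof (rule groupI)
  show "\<one>\<^bsub>braid_group n\<^esub> \<in> carrier (braid_group n)" by (simp add: one_braid_group braid_class_carrier)
  fix x assume "x \<in> carrier (braid_group n)"
  then obtain u where u: "u \<in> braid_words n" "x = braid_class n u" by (rule braid_group_carrierE)
  show "\<one>\<^bsub>braid_group n\<^esub> \<otimes>\<^bsub>braid_group n\<^esub> x = x" using u by (simp add: one_braid_group braid_class_mult)
  have "braid_class n (inv_word u) \<otimes>\<^bsub>braid_group n\<^esub> x = \<one>\<^bsub>braid_group n\<^esub>"
    using u inv_word_append_rel[of u n] by (simp add: one_braid_group braid_class_mult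
      braid_class_eq_iff)
  then show "\<exists>y\<in>carrier (braid_group n). y \<otimes>\<^bsub>braid_group n\<^esub> x = \<one>\<^bsub>braid_group n\<^esub>"
    using u braid_class_carrier[of "inv_word u" n] by auto
  fix y assume "y \<in> carrier (braid_group n)"
  then obtain v where v: "v \<in> braid_words n" "y = braid_class n v" by (rule braid_group_carrierE)
  show "x \<otimes>\<^bsub>braid_group n\<^esub> y \<in> carrier (braid_group n)"
    using u v by (simp add: braid_class_mult braid_class_carrier)
  fix z assume "z \<in> carrier (braid_group n)"
  then obtain w where w: "w \<in> braid_words n" "z = braid_class n w" by (rule braid_group_carrierE)
  show "x \<otimes>\<^bsub>braid_group n\<^esub> y \<otimes>\<^bsub>braid_group n\<^esub> z = x \<otimes>\<^bsub>braid_group n\<^esub> (y \<otimes>\<^bsub>braid_group n\<^esub> z)"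
    using u v w by (simp add: braid_class_mult)
qed

lemma inv_braid_class:
  assumes "w \<in> braid_words n"
  shows "inv\<^bsub>braid_group n\<^esub> braid_class n w = braid_class n (inv_word w)"
proof (rule group.inv_equality[OF group_braid_group])
  show "braid_class n (inv_word w) \<otimes>\<^bsub>braid_group n\<^esub> braid_class n w = \<one>\<^bsub>braid_group n\<^esub>"
    using assms inv_word_append_rel[of w n] by (simp add: one_braid_group braid_class_mult
      braid_class_eq_iff)
qed (use assms in \<open>simp_all add: braid_class_carrier\<close>)

text \<open>
  Evaluates the functions on braids that are given as the common value on all representing words.
\<close>

lemma the_elem_image_braid_class:
  assumes "w \<in> braid_words n" and "\<And>v. (w, v) \<in> braid_rel n \<Longrightarrow> f v = f w"
  shows "the_elem (f ` braid_class n w) = f w"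
proof -
  have "f v = f w" if "v \<in> braid_class n w" for v
    using assms(2) that by (simp add: braid_class_def)
  then have "f ` braid_class n w = {f w}"
    using mem_braid_class[OF assms(1)] by blast
  then show ?thesis by simp
qed

lemma word_exponent_append [simp]: "word_exponent (u @ v) = word_exponent u + word_exponent v"
  by (simp add: word_exponent_def)

lemma word_exponent_Cons [simp]: "word_exponent ((i, b) # w) = (if b then 1 else - 1) + word_exponent w"
  by (simp add: word_exponent_def)

lemma word_exponent_Nil [simp]: "word_exponent [] = 0"
  by (simp add: word_exponent_def)

lemma word_exponent_inv_word [simp]: "word_exponent (inv_word w) = - word_exponent w"
  by (induction w) auto

lemma word_exponent_braid_rel: "(u, v) \<in> braid_rel n \<Longrightarrow> word_exponent v = word_exponent u"
  by (induction rule: braid_rel.induct) auto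

lemma braid_exponent_braid_class:
  "w \<in> braid_words n \<Longrightarrow> braid_exponent (braid_class n w) = word_exponent w"
  unfolding braid_exponent_def by (rule the_elem_image_braid_class) (auto dest: word_exponent_braid_rel)

section \<open>Braid group representations from unitary generalized Yang--Baxter operators\<close>

text \<open>
  Padding with identities on both sides is multiplicative; so relations between a few neighbouring
  generators need only be checked on the factors on which they act.
\<close>

lemma kron_sandwich_mult:
  assumes "X \<in> carrier_mat p p" "Y \<in> carrier_mat p p"
  shows "kron (1\<^sub>m a) (kron X (1\<^sub>m b)) * kron (1\<^sub>m a) (kron Y (1\<^sub>m b))
    = kron (1\<^sub>m a) (kron (X * Y) (1\<^sub>m b))"
proof -
  have "kron X (1\<^sub>m b) * kron Y (1\<^sub>m b) = kron (X * Y) (1\<^sub>m b)"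
    using kron_mult[OF assms(1) one_carrier_mat assms(2) one_carrier_mat] by simp
  then show ?thesis
    using kron_mult[OF one_carrier_mat[of a] kron_carrier[OF assms(1) one_carrier_mat[of b]]
        one_carrier_mat[of a] kron_carrier[OF assms(2) one_carrier_mat[of b]]] by simp
qed

text \<open>
  Unitarity makes the inverse of every generator its adjoint, so that the image of the
  representation is closed under adjoints.  This is what lets the perpendicularity condition, which
  involves adjoints, speak about the trace of the represented braids themselves.
\<close>

locale unitary_gyb =
  fixes d k m :: nat and R :: "complex mat"
  assumes gyb: "gyb_operator d k m R"
    and unitary: "R * mat_adjoint R = 1\<^sub>m (d ^ k)"
begin

abbreviation "gen \<equiv> gyb_gen d m R"
abbreviation "rep_dim n \<equiv> d ^ gyb_len k m n"
abbreviation "rep_word \<equiv> gyb_word d k m R"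
abbreviation "rep \<equiv> gyb_rep d k m R"

lemma R_carrier: "R \<in> carrier_mat (d ^ k) (d ^ k)"
  using gyb by (simp add: gyb_operator_def)

lemma mat_inv_R: "mat_inv R = mat_adjoint R"
  by (rule mat_inv_eqI[OF R_carrier mat_adjoint_carrier[OF R_carrier] unitary])

lemma gyb_len_split:
  assumes "1 \<le> i" "i < n"
  shows "gyb_len k m n = m * (i - 1) + (k + m * (n - i - 1))"
proof -
  define a b where "a = i - 1" and "b = n - i - 1"
  have n: "n = a + b + 2" using assms by (simp add: a_def b_def)
  show ?thesis
    by (simp only: a_def[symmetric] b_def[symmetric]) (simp add: gyb_len_def n algebra_simps)
qed

lemma rep_dim_split:
  assumes "1 \<le> i" "i < n"
  shows "d ^ (m * (i - 1)) * (d ^ k * d ^ (m * (n - i - 1))) = rep_dim n"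
  by (simp only: gyb_len_split[OF assms] power_add)

lemma gen_carrier: "1 \<le> i \<Longrightarrow> i < n \<Longrightarrow> gen n i \<in> carrier_mat (rep_dim n) (rep_dim n)"
  unfolding gyb_gen_def
  using kron_carrier[OF one_carrier_mat kron_carrier[OF R_carrier one_carrier_mat]] rep_dim_split
    by metis

lemma gen_adjoint:
  "mat_adjoint (gen n i) = kron (1\<^sub>m (d ^ (m * (i - 1)))) (kron (mat_adjoint R) (1\<^sub>m (d ^ (m *
    (n - i - 1)))))"
  unfolding gyb_gen_def
  using mat_adjoint_kron[OF one_carrier_mat kron_carrier[OF R_carrier one_carrier_mat]]
    mat_adjoint_kron[OF R_carrier one_carrier_mat] by simp

lemma gen_unitary:
  assumes "1 \<le> i" "i < n"
  shows "gen n i * mat_adjoint (gen n i) = 1\<^sub>m (rep_dim n)"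
  unfolding gen_adjoint unfolding gyb_gen_def
  by (simp only: kron_sandwich_mult[OF R_carrier mat_adjoint_carrier[OF R_carrier]] unitary
      kron_one_one rep_dim_split[OF assms])

lemma mat_inv_gen: "1 \<le> i \<Longrightarrow> i < n \<Longrightarrow> mat_inv (gen n i) = mat_adjoint (gen n i)"
  using mat_inv_eqI[OF gen_carrier mat_adjoint_carrier[OF gen_carrier] gen_unitary] .

lemma gen_unitary':
  assumes "1 \<le> i" "i < n"
  shows "mat_adjoint (gen n i) * gen n i = 1\<^sub>m (rep_dim n)"
  using mat_mult_left_right_inverse[OF gen_carrier[OF assms] mat_adjoint_carrier[OF gen_carrier[OF
    assms]]
      gen_unitary[OF assms]] .

text \<open>
  The common padding of two generators at distance \<open>p\<close> is split off here and in the next lemma;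
  for \<open>p = 1\<close> and \<open>p \<ge> 2\<close> what remains are the two sides of the defining equations of a generalized
  Yang--Baxter operator.
\<close>

lemma gen_split_left:
  assumes "1 \<le> i" "i + p < n"
  shows "gen n i = kron (1\<^sub>m (d ^ (m * (i - 1)))) (kron (kron R (1\<^sub>m (d ^ (m * p)))) (1\<^sub>m (d ^ (m *
    (n - (i + p) - 1)))))"
proof -
  have "n - i - 1 = p + (n - (i + p) - 1)" using assms by simp
  then have "1\<^sub>m (d ^ (m * (n - i - 1))) = kron (1\<^sub>m (d ^ (m * p))) (1\<^sub>m (d ^ (m * (n - (i + p) - 1))))"
    by (simp only: kron_one_one distrib_left power_add)
  then show ?thesis by (simp only: gyb_gen_def kron_assoc)
qed

lemma gen_split_right:
  assumes "1 \<le> i" "i + p < n"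
  shows "gen n (i + p) = kron (1\<^sub>m (d ^ (m * (i - 1)))) (kron (kron (1\<^sub>m (d ^ (m * p))) R) (1\<^sub>m (d ^
    (m * (n - (i + p) - 1)))))"
proof -
  have "i + p - 1 = (i - 1) + p" using assms by simp
  then have "1\<^sub>m (d ^ (m * (i + p - 1))) = kron (1\<^sub>m (d ^ (m * (i - 1)))) (1\<^sub>m (d ^ (m * p)))"
    by (simp only: kron_one_one distrib_left power_add)
  then show ?thesis by (simp only: gyb_gen_def kron_assoc)
qed

lemma kron_R_carrier:
  "kron R (1\<^sub>m a) \<in> carrier_mat (d ^ k * a) (d ^ k * a)"
  "kron (1\<^sub>m a) R \<in> carrier_mat (d ^ k * a) (d ^ k * a)"
  using kron_carrier[OF R_carrier one_carrier_mat[of a]] kron_carrier[OF one_carrier_mat[of a]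
    R_carrier]
  by (simp_all add: mult.commute)

lemma gen_far:
  assumes "1 \<le> i" "i + 2 \<le> j" "j < n"
  shows "gen n i * gen n j = gen n j * gen n i"
proof -
  define p where "p = j - i"
  have p: "2 \<le> p" "j = i + p" "i + p < n" using assms by (auto simp: p_def)
  have "p + 2 \<ge> 4" using p by simp
  then have comm: "kron R (1\<^sub>m (d ^ (m * p))) * kron (1\<^sub>m (d ^ (m * p))) R = kron (1\<^sub>m (d ^ (m *
    p))) R * kron R (1\<^sub>m (d ^ (m * p)))"
    using gyb unfolding gyb_operator_def Let_def by (metis add_diff_cancel_right')
  show ?thesis
    unfolding p(2) gen_split_left[OF assms(1) p(3)] gen_split_right[OF assms(1) p(3)]
    by (simp only: kron_sandwich_mult[OF kron_R_carrier] kron_sandwich_mult[OF kron_R_carrier(2,1)]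
      comm)
qed

lemma gen_braid:
  assumes "1 \<le> i" "i + 1 < n"
  shows "gen n i * gen n (i + 1) * gen n i = gen n (i + 1) * gen n i * gen n (i + 1)"
proof -
  let ?A = "kron R (1\<^sub>m (d ^ m))" and ?B = "kron (1\<^sub>m (d ^ m)) R"
  have comm: "?A * ?B * ?A = ?B * ?A * ?B"
    using gyb unfolding gyb_operator_def Let_def by blast
  note c = kron_R_carrier[of "d ^ m"]
  show ?thesis
    using gen_split_left[OF assms] gen_split_right[OF assms]
    by (simp only: mult_1_right kron_sandwich_mult[OF c] kron_sandwich_mult[OF c(2,1)]
        kron_sandwich_mult[OF mult_carrier_mat[OF c] c(1)]
        kron_sandwich_mult[OF mult_carrier_mat[OF c(2,1)] c(2)] comm)
qed

lemma rep_word_Nil [simp]: "rep_word n [] = 1\<^sub>m (rep_dim n)"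
  by (simp add: gyb_word_def)

lemma rep_word_Cons:
  assumes "1 \<le> i" "i < n"
  shows "rep_word n ((i, b) # w) = (if b then gen n i else mat_adjoint (gen n i)) * rep_word n w"
  using assms by (simp add: gyb_word_def mat_inv_gen)

lemma letter_carrier:
  "1 \<le> i \<Longrightarrow> i < n \<Longrightarrow> (if b then gen n i else mat_adjoint (gen n i)) \<in> carrier_mat (rep_dim n) (rep_dim n)"
  using gen_carrier mat_adjoint_carrier[OF gen_carrier] by auto

lemma rep_word_carrier: "w \<in> braid_words n \<Longrightarrow> rep_word n w \<in> carrier_mat (rep_dim n) (rep_dim n)"
proof (induction w)
  case (Cons l w)
  then show ?case
    by (cases l) (auto simp only: braid_words_simps rep_word_Cons intro!: mult_carrier_mat
      letter_carrier)
qed simp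

lemma rep_word_append:
  assumes "v \<in> braid_words n"
  shows "u \<in> braid_words n \<Longrightarrow> rep_word n (u @ v) = rep_word n u * rep_word n v"
proof (induction u)
  case Nil
  then show ?case using left_mult_one_mat[OF rep_word_carrier[OF assms]] by simp
next
  case (Cons l u)
  obtain i b where l: "l = (i, b)" by (cases l)
  have *: "1 \<le> i" "i < n" "u \<in> braid_words n" using Cons.prems l by auto
  show ?case
    using Cons.IH[OF *(3)] assoc_mult_mat[OF letter_carrier[OF *(1,2)] rep_word_carrier[OF *(3)]
      rep_word_carrier[OF assms]]
    by (simp only: l append_Cons rep_word_Cons[OF *(1,2)])
qed

lemma rep_word_single: "1 \<le> i \<Longrightarrow> i < n \<Longrightarrow> rep_word n [(i, b)] = (if b then gen n i else mat_adjoint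
  (gen n i))"
  using right_mult_one_mat[OF letter_carrier] by (simp only: rep_word_Cons rep_word_Nil)

lemma rep_word_inv_word: "w \<in> braid_words n \<Longrightarrow> rep_word n (inv_word w) = mat_adjoint (rep_word n w)"
proof (induction w)
  case (Cons l w)
  obtain i b where l: "l = (i, b)" by (cases l)
  have *: "1 \<le> i" "i < n" "w \<in> braid_words n" using Cons.prems l by auto
  have "rep_word n (inv_word (l # w)) = mat_adjoint (rep_word n w) * (if \<not> b then gen n i else
    mat_adjoint (gen n i))"
    using * Cons.IH[OF *(3)] by (simp only: l inv_word_simps rep_word_append rep_word_single
      braid_words_simps
        inv_word_braid_words if_True simp_thms)
  also have "\<dots> = mat_adjoint (rep_word n w) * mat_adjoint (if b then gen n i else mat_adjoint (gen n
    i))"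
    by simp
  also have "\<dots> = mat_adjoint (rep_word n (l # w))"
    unfolding l rep_word_Cons[OF *(1,2)]
    by (rule mat_adjoint_mult[OF letter_carrier[OF *(1,2)] rep_word_carrier[OF *(3)], symmetric])
  finally show ?case .
qed simp

text \<open>
  Cancellation holds by unitarity and the other two relations by the defining equations of the
  operator, so words may be replaced by the braids that they represent.
\<close>

lemma rep_word_braid_rel: "(u, v) \<in> braid_rel n \<Longrightarrow> rep_word n u = rep_word n v"
proof (induction rule: braid_rel.induct)
  case (cancel u v i b)
  have "rep_word n ([(i, b)] @ [(i, \<not> b)]) = 1\<^sub>m (rep_dim n)"
    using cancel by (subst rep_word_append) (auto simp: rep_word_single gen_unitary gen_unitary')
  then have "rep_word n ([(i, b), (i, \<not> b)] @ v) = rep_word n v"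
    using cancel left_mult_one_mat[OF rep_word_carrier[of v n]] rep_word_append[of v n "[(i, b), (i,
      \<not> b)]"] by simp
  then show ?case using cancel by (simp add: rep_word_append del: append_Cons)
next
  case (far u v i j)
  have "rep_word n ([(i, True)] @ [(j, True)]) = rep_word n ([(j, True)] @ [(i, True)])"
    using far gen_far by (subst (1 2) rep_word_append) (auto simp: rep_word_single)
  then have "rep_word n ([(i, True), (j, True)] @ v) = rep_word n ([(j, True), (i, True)] @ v)"
    using far by (subst (1 2) rep_word_append) auto
  then show ?case using far by (simp add: rep_word_append del: append_Cons)
next
  case (braid u v i)
  let ?x = "[(i, True), (i + 1, True), (i, True)]" and ?y = "[(i + 1, True), (i, True), (i + 1, True)]"
  have triple: "rep_word n [(p, True), (q, True), (p, True)] = gen n p * gen n q * gen n p"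
    if "1 \<le> p" "p < n" "1 \<le> q" "q < n" for p q
    using that by (simp add: rep_word_Cons right_mult_one_mat[OF gen_carrier]
        assoc_mult_mat[OF gen_carrier gen_carrier gen_carrier])
  have "rep_word n ?x = rep_word n ?y"
    using braid triple[of i "i + 1"] triple[of "i + 1" i] gen_braid[of i n] by simp
  then have "rep_word n (?x @ v) = rep_word n (?y @ v)"
    using braid by (subst (1 2) rep_word_append) auto
  then show ?case using braid by (simp add: rep_word_append del: append_Cons)
qed auto

lemma rep_braid_class: "w \<in> braid_words n \<Longrightarrow> rep n (braid_class n w) = rep_word n w"
  unfolding gyb_rep_def by (rule the_elem_image_braid_class) (auto dest: rep_word_braid_rel)

lemma rep_image: "rep n ` carrier (braid_group n) = rep_word n ` braid_words n"
  by (force simp: rep_braid_class image_iff elim: braid_group_carrierE intro: braid_class_carrier)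

end

section \<open>Markov invariance of the normalized trace\<close>

lemma gyb_len_eq: "1 \<le> n \<Longrightarrow> m < k \<Longrightarrow> gyb_len k m n = m * (n - 1) + (k - m)"
  by (cases n) (auto simp: gyb_len_def algebra_simps)

lemma gyb_len_Suc: "1 \<le> n \<Longrightarrow> m < k \<Longrightarrow> gyb_len k m (Suc n) = gyb_len k m n + m"
  by (cases n) (auto simp: gyb_len_def algebra_simps)

locale unitary_egyb = unitary_gyb +
  fixes \<mu> :: "complex mat" and \<alpha> \<beta> :: complex
  assumes egyb: "egyb_operator d k m R \<mu> \<alpha> \<beta>"
begin

lemma m_less_k: "m < k" and \<mu>_carrier: "\<mu> \<in> carrier_mat d d"
  and \<alpha>_nz: "\<alpha> \<noteq> 0" and \<beta>_nz: "\<beta> \<noteq> 0" and \<mu>_R: "kron_pow \<mu> k * R = R * kron_pow \<mu> k"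
  using egyb by (auto simp: egyb_operator_def)

abbreviation "mu n \<equiv> kron_pow \<mu> (gyb_len k m n)"

lemma mu_carrier: "mu n \<in> carrier_mat (rep_dim n) (rep_dim n)"
  by (rule kron_pow_carrier[OF \<mu>_carrier])

lemma mu_gen:
  assumes "1 \<le> i" "i < n"
  shows "mu n * gen n i = gen n i * mu n"
proof -
  define a b where "a = m * (i - 1)" and "b = m * (n - i - 1)"
  have len: "gyb_len k m n = a + (k + b)"
    unfolding a_def b_def by (rule gyb_len_split[OF assms])
  have gen: "gen n i = kron (1\<^sub>m (d ^ a)) (kron R (1\<^sub>m (d ^ b)))"
    by (simp only: gyb_gen_def a_def b_def)
  have c: "kron_pow \<mu> j \<in> carrier_mat (d ^ j) (d ^ j)" for j
    by (rule kron_pow_carrier[OF \<mu>_carrier])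
  have 1: "kron (kron_pow \<mu> k) (kron_pow \<mu> b) * kron R (1\<^sub>m (d ^ b)) = kron (kron_pow \<mu> k *
    R) (kron_pow \<mu> b)"
    using kron_mult[OF c c R_carrier one_carrier_mat] right_mult_one_mat[OF c] by simp
  have 2: "kron R (1\<^sub>m (d ^ b)) * kron (kron_pow \<mu> k) (kron_pow \<mu> b) = kron (kron_pow \<mu> k *
    R) (kron_pow \<mu> b)"
    using kron_mult[OF R_carrier one_carrier_mat c c] left_mult_one_mat[OF c] by (simp add: \<mu>_R)
  have "mu n * gen n i = kron (kron_pow \<mu> a) (kron (kron_pow \<mu> k * R) (kron_pow \<mu> b))"
    unfolding gen len kron_pow_add
    using kron_mult[OF c kron_carrier[OF c c] one_carrier_mat kron_carrier[OF R_carrier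
      one_carrier_mat]]
      right_mult_one_mat[OF c] by (simp add: 1)
  also have "\<dots> = gen n i * mu n"
    unfolding gen len kron_pow_add
    using kron_mult[OF one_carrier_mat kron_carrier[OF R_carrier one_carrier_mat] c kron_carrier[OF c
      c]]
      left_mult_one_mat[OF c] by (simp add: 2)
  finally show ?thesis .
qed

lemma mu_gen_adjoint:
  assumes "1 \<le> i" "i < n"
  shows "mu n * mat_adjoint (gen n i) = mat_adjoint (gen n i) * mu n"
proof -
  let ?g = "gen n i" and ?h = "mat_adjoint (gen n i)"
  note M = mu_carrier[of n] and g = gen_carrier[OF assms] and h =
    mat_adjoint_carrier[OF gen_carrier[OF assms]]
  have "?g * (mu n * ?h) = mu n * (?g * ?h)"
    by (simp only: assoc_mult_mat[OF g M h, symmetric] mu_gen[OF assms, symmetric] assoc_mult_mat[OF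
      M g h])
  then have "?h * ?g * (mu n * ?h) = ?h * mu n"
    by (simp only: assoc_mult_mat[OF h g mult_carrier_mat[OF M h]] gen_unitary[OF assms]
      right_mult_one_mat[OF M])
  then show ?thesis
    by (simp only: gen_unitary'[OF assms] left_mult_one_mat[OF mult_carrier_mat[OF M h]])
qed

text \<open>
  On the factors where a generator acts this is the commutation of the \<open>k\<close>-th tensor power of \<open>\<mu>\<close>
  with \<open>R\<close>; on the others the generator is the identity.
\<close>

lemma mu_rep_word: "w \<in> braid_words n \<Longrightarrow> mu n * rep_word n w = rep_word n w * mu n"
proof (induction w)
  case Nil
  then show ?case using mu_carrier[of n] by simp
next
  case (Cons l w)
  obtain i b where l: "l = (i, b)" by (cases l)
  have *: "1 \<le> i" "i < n" "w \<in> braid_words n" using Cons.prems l by auto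
  let ?g = "if b then gen n i else mat_adjoint (gen n i)"
  have g: "?g \<in> carrier_mat (rep_dim n) (rep_dim n)" by (rule letter_carrier[OF *(1,2)])
  have c: "mu n * ?g = ?g * mu n" using mu_gen[OF *(1,2)] mu_gen_adjoint[OF *(1,2)] by simp
  have "mu n * (?g * rep_word n w) = (mu n * ?g) * rep_word n w"
    by (rule assoc_mult_mat[OF mu_carrier g rep_word_carrier[OF *(3)], symmetric])
  also have "\<dots> = ?g * (mu n * rep_word n w)"
    unfolding c by (rule assoc_mult_mat[OF g mu_carrier rep_word_carrier[OF *(3)]])
  also have "\<dots> = (?g * rep_word n w) * mu n"
    unfolding Cons.IH[OF *(3)] by (rule assoc_mult_mat[OF g rep_word_carrier[OF *(3)] mu_carrier,
      symmetric])
  finally show ?case unfolding l rep_word_Cons[OF *(1,2)] .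
qed

text \<open>
  The trace before normalization by the powers of \<open>\<alpha>\<close> and \<open>\<beta>\<close>.
\<close>

definition word_trace :: "nat \<Rightarrow> letter list \<Rightarrow> complex" where
  "word_trace n w = mat_trace (rep_word n w * mu n)"

lemma word_trace_braid_rel: "(u, v) \<in> braid_rel n \<Longrightarrow> word_trace n u = word_trace n v"
  by (simp add: word_trace_def rep_word_braid_rel)

text \<open>
  Cyclicity of the trace, together with the commutation of the tensor powers of \<open>\<mu>\<close> with the
  representation.
\<close>

lemma word_trace_swap:
  assumes "u \<in> braid_words n" "v \<in> braid_words n"
  shows "word_trace n (u @ v) = word_trace n (v @ u)"
proof -
  note c = rep_word_carrier[OF assms(1)] rep_word_carrier[OF assms(2)] mu_carrier[of n]
  have "word_trace n (u @ v) = mat_trace (rep_word n u * (rep_word n v * mu n))"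
    using assms c by (simp add: word_trace_def rep_word_append)
  also have "\<dots> = mat_trace (rep_word n v * mu n * rep_word n u)"
    by (rule mat_trace_mult_commute[OF c(1) mult_carrier_mat[OF c(2,3)]])
  also have "rep_word n v * mu n * rep_word n u = rep_word n v * rep_word n u * mu n"
    unfolding assoc_mult_mat[OF c(2,3,1)] mu_rep_word[OF assms(1)] assoc_mult_mat[OF c(2,1,3)] ..
  finally show ?thesis using assms by (simp add: word_trace_def rep_word_append)
qed

lemma word_trace_conjugate:
  assumes "u \<in> braid_words n" "w \<in> braid_words n"
  shows "word_trace n (u @ w @ inv_word u) = word_trace n w"
proof -
  have "word_trace n (u @ w @ inv_word u) = word_trace n ((w @ inv_word u) @ u)"
    by (rule word_trace_swap) (use assms in auto)
  also have "\<dots> = word_trace n (w @ [])"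
    using assms braid_rel_append[OF braid_rel.refl[OF assms(2)] inv_word_append_rel[OF assms(1)]]
    by (intro word_trace_braid_rel) simp
  finally show ?thesis by simp
qed

lemma gen_Suc:
  assumes "1 \<le> i" "i < n"
  shows "gen (Suc n) i = kron (gen n i) (1\<^sub>m (d ^ m))"
proof -
  have "Suc n - i - 1 = (n - i - 1) + 1" using assms by simp
  then have "1\<^sub>m (d ^ (m * (Suc n - i - 1))) = kron (1\<^sub>m (d ^ (m * (n - i - 1)))) (1\<^sub>m (d ^ m))"
    by (simp only: kron_one_one distrib_left power_add mult_1_right)
  then show ?thesis by (simp only: gyb_gen_def kron_assoc)
qed

text \<open>
  An additional strand that no letter touches contributes \<open>m\<close> tensor factors on which the
  operator is the identity.
\<close>

lemma rep_word_Suc: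
  assumes "1 \<le> n"
  shows "w \<in> braid_words n \<Longrightarrow> rep_word (Suc n) w = kron (rep_word n w) (1\<^sub>m (d ^ m))"
proof (induction w)
  case Nil
  then show ?case using assms by (simp add: gyb_len_Suc[OF assms m_less_k] power_add)
next
  case (Cons l w)
  obtain i b where l: "l = (i, b)" by (cases l)
  have *: "1 \<le> i" "i < n" "w \<in> braid_words n" using Cons.prems l by auto
  then have **: "i < Suc n" by simp
  let ?g = "if b then gen n i else mat_adjoint (gen n i)"
  have "(if b then gen (Suc n) i else mat_adjoint (gen (Suc n) i)) = kron ?g (1\<^sub>m (d ^ m))"
    using gen_Suc[OF *(1,2)] mat_adjoint_kron[OF gen_carrier[OF *(1,2)] one_carrier_mat[of "d ^ m"]]
      by simp
  then show ?case
    using kron_mult[OF letter_carrier[OF *(1,2)] one_carrier_mat[of "d ^ m"] rep_word_carrier[OF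
      *(3)] one_carrier_mat[of "d ^ m"]]
      Cons.IH[OF *(3)] by (simp only: l rep_word_Cons[OF *(1,2)] rep_word_Cons[OF *(1) **]
        left_mult_one_mat[OF one_carrier_mat])
qed

text \<open>
  By unitarity a represented braid is the adjoint of the represented inverse braid, so
  perpendicularity to the image makes the plain trace vanish.
\<close>

lemma perp_rep_trace:
  assumes n: "1 \<le> n" and w: "w \<in> braid_words n"
    and g: "g \<in> perp (rep_dim n) (rep n ` carrier (braid_group n))"
  shows "mat_trace (rep_word n w * g) = 0"
proof -
  have "rep_word n (inv_word w) \<in> rep n ` carrier (braid_group n)"
    unfolding rep_image using w by simp
  with g have "mat_trace (mat_adjoint (rep_word n (inv_word w)) * g) = 0" unfolding perp_def by blast
  then show ?thesis using rep_word_inv_word[of "inv_word w" n] w by simp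
qed

text \<open>
  The new strand enters only through the last generator, so tracing out its \<open>m\<close> factors replaces
  \<open>R\<close> by its partial trace.  The enhancement condition says that in this position the partial trace
  may be replaced by \<open>\<alpha>\<beta>\<close> (or \<open>\<alpha>\<inverse>\<beta>\<close> for a negative crossing) times a power of \<open>\<mu>\<close>: the
  difference has trace zero against every represented braid.
\<close>

lemma word_trace_stabilize:
  assumes n: "1 \<le> n" and w: "w \<in> braid_words n"
  shows "word_trace (Suc n) (w @ [(n, b)]) = (if b then \<alpha> else inverse \<alpha>) * \<beta> * word_trace n w"
proof -
  define X where "X = (if b then R else mat_adjoint R)"
  define a where "a = (if b then \<alpha> else inverse \<alpha>)"
  let ?p = "m * (n - 1)" and ?Sp = "partial_trace d k m (X * kron_pow \<mu> k)" and ?A = "rep_word n w"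
  have c: "kron_pow \<mu> j \<in> carrier_mat (d ^ j) (d ^ j)" for j
    by (rule kron_pow_carrier[OF \<mu>_carrier])
  have X: "X \<in> carrier_mat (d ^ k) (d ^ k)"
    using R_carrier mat_adjoint_carrier[OF R_carrier] by (simp add: X_def)
  have len: "gyb_len k m n = ?p + (k - m)" by (rule gyb_len_eq[OF n m_less_k])
  have len': "gyb_len k m (Suc n) = ?p + k" using len gyb_len_Suc[OF n m_less_k] m_less_k by simp
  have A: "?A \<in> carrier_mat (rep_dim n) (rep_dim n)" by (rule rep_word_carrier[OF w])
  have single: "rep_word (Suc n) [(n, b)] = kron (1\<^sub>m (d ^ ?p)) X"
    using n kron_one_right by (simp add: rep_word_single gen_adjoint X_def) (simp add: gyb_gen_def)
  have single_carrier: "kron (1\<^sub>m (d ^ ?p)) X \<in> carrier_mat (rep_dim (Suc n)) (rep_dim (Suc n))"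
    using kron_carrier[OF one_carrier_mat X] by (simp add: len' power_add)
  have A1: "kron ?A (1\<^sub>m (d ^ m)) \<in> carrier_mat (rep_dim (Suc n)) (rep_dim (Suc n))"
    using kron_carrier[OF A one_carrier_mat[of "d ^ m"]] by (simp add: gyb_len_Suc[OF n m_less_k]
      power_add)
  have w': "w \<in> braid_words (Suc n)" "[(n, b)] \<in> braid_words (Suc n)"
    using w braid_words_mono[of w n "Suc n"] n by auto
  have "word_trace (Suc n) (w @ [(n, b)]) = mat_trace (kron ?A (1\<^sub>m (d ^ m)) * kron (1\<^sub>m (d ^ ?p)) X
    * mu (Suc n))"
    by (simp only: word_trace_def rep_word_append[OF w'(2,1)] rep_word_Suc[OF n w] single)
  also have "\<dots> = mat_trace (kron ?A (1\<^sub>m (d ^ m)) * (kron (1\<^sub>m (d ^ ?p)) X * mu (Suc n)))"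
    by (simp only: assoc_mult_mat[OF A1 single_carrier mu_carrier])
  also have "kron (1\<^sub>m (d ^ ?p)) X * mu (Suc n) = kron (kron_pow \<mu> ?p) (X * kron_pow \<mu> k)"
    unfolding len' kron_pow_add kron_mult[OF one_carrier_mat X c c] left_mult_one_mat[OF c] ..
  also have "mat_trace (kron ?A (1\<^sub>m (d ^ m)) * \<dots>) = mat_trace (?A * partial_trace d (?p + k) m (kron
    (kron_pow \<mu> ?p) (X * kron_pow \<mu> k)))"
  proof (rule mat_trace_kron_one_mult)
    show "kron (kron_pow \<mu> ?p) (X * kron_pow \<mu> k) \<in> carrier_mat (d ^ (?p + k)) (d ^ (?p + k))"
      using kron_carrier[OF c mult_carrier_mat[OF X c]] by (simp add: power_add)
  qed (use A m_less_k in \<open>simp_all add: len\<close>)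
  also have "partial_trace d (?p + k) m (kron (kron_pow \<mu> ?p) (X * kron_pow \<mu> k)) =
    kron (kron_pow \<mu> ?p) ?Sp"
    using m_less_k by (intro partial_trace_kron[OF _ c mult_carrier_mat[OF X c]]) simp
  also have "mat_trace (?A * kron (kron_pow \<mu> ?p) ?Sp) = a * \<beta> * word_trace n w"
  proof -
    let ?g = "kron (kron_pow \<mu> ?p) (?Sp - (a * \<beta>) \<cdot>\<^sub>m kron_pow \<mu> (k - m))"
    have "?g \<in> perp (rep_dim n) (rep n ` carrier (braid_group n))"
      using egyb n by (cases b) (simp_all add: egyb_operator_def Let_def X_def a_def mat_inv_R)
    then have "mat_trace (?A * ?g) = 0" by (rule perp_rep_trace[OF n w])
    moreover have "?g = kron (kron_pow \<mu> ?p) ?Sp - (a * \<beta>) \<cdot>\<^sub>m mu n"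
      unfolding kron_minus_right[OF c partial_trace_carrier smult_carrier_mat[OF c]] kron_smult_right
        len kron_pow_add ..
    moreover have S: "kron (kron_pow \<mu> ?p) ?Sp \<in> carrier_mat (rep_dim n) (rep_dim n)"
      using kron_carrier[OF c partial_trace_carrier] by (simp add: len power_add)
    ultimately have "mat_trace (?A * kron (kron_pow \<mu> ?p) ?Sp - (a * \<beta>) \<cdot>\<^sub>m (?A * mu n)) = 0"
      by (simp only: mult_minus_distrib_mat[OF A S smult_carrier_mat[OF mu_carrier]]
        mult_smult_distrib[OF A mu_carrier])
    then show ?thesis
      unfolding mat_trace_minus[OF mult_carrier_mat[OF A S] smult_carrier_mat[OF mult_carrier_mat[OF
        A mu_carrier]]]
        mat_trace_smult[OF mult_carrier_mat[OF A mu_carrier]] word_trace_def by simp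
  qed
  finally show ?thesis by (simp add: a_def)
qed

abbreviation "invariant \<equiv> braid_invariant d k m R \<mu> \<alpha> \<beta>"

lemma invariant_braid_class:
  "w \<in> braid_words n \<Longrightarrow>
    invariant n (braid_class n w) = \<alpha> powi (- word_exponent w) * \<beta> powi (- int n) * word_trace n w"
  by (simp add: braid_invariant_def braid_exponent_braid_class rep_braid_class word_trace_def)

lemma invariant_conjugate:
  assumes "\<xi> \<in> carrier (braid_group n)" "\<eta> \<in> carrier (braid_group n)"
  shows "invariant n (\<eta> \<otimes>\<^bsub>braid_group n\<^esub> \<xi> \<otimes>\<^bsub>braid_group n\<^esub> inv\<^bsub>braid_group n\<^esub> \<eta>) = invariant n \<xi>"
proof -
  obtain w where w: "w \<in> braid_words n" "\<xi> = braid_class n w" using assms(1)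
    by (rule braid_group_carrierE)
  obtain u where u: "u \<in> braid_words n" "\<eta> = braid_class n u" using assms(2)
    by (rule braid_group_carrierE)
  show ?thesis
    using w u word_trace_conjugate[OF u(1) w(1)]
    by (simp add: inv_braid_class braid_class_mult invariant_braid_class)
qed

text \<open>
  The factor picked up by the trace is exactly compensated by the changes of the exponent sum and
  of the number of strands in the normalization.
\<close>

lemma invariant_stabilize:
  assumes "1 \<le> n" "w \<in> braid_words n"
  shows "invariant (Suc n) (braid_class (Suc n) (w @ [(n, b)])) = invariant n (braid_class n w)"
proof -
  let ?s = "if b then 1 else - 1 :: int"
  have w: "w @ [(n, b)] \<in> braid_words (Suc n)" using assms braid_words_mono[of w n "Suc n"] by simp
  have *: "- word_exponent (w @ [(n, b)]) = - word_exponent w + - ?s" "- int (Suc n) = - int n + - 1"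
    "(if b then \<alpha> else inverse \<alpha>) = \<alpha> powi ?s"
    by (simp_all add: power_int_minus)
  have "invariant (Suc n) (braid_class (Suc n) (w @ [(n, b)])) =
      \<alpha> powi (- word_exponent w + - ?s) * \<beta> powi (- int n + - 1) * (\<alpha> powi ?s * \<beta> * word_trace n w)"
    unfolding invariant_braid_class[OF w] word_trace_stabilize[OF assms] by (simp only: *)
  also have "\<dots> = (\<alpha> powi (- ?s) * \<alpha> powi ?s) * (\<beta> powi (- 1) * \<beta>) * invariant n (braid_class n w)"
    unfolding invariant_braid_class[OF assms(2)] power_int_add[OF disjI1[OF \<alpha>_nz]] power_int_add[OF
      disjI1[OF \<beta>_nz]]
    by (simp add: mult_ac)
  also have "\<dots> = invariant n (braid_class n w)"
    using \<alpha>_nz \<beta>_nz by (simp add: power_int_minus)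
  finally show ?thesis .
qed

theorem invariant_markov: "markov_equiv n \<xi> n' \<xi>' \<Longrightarrow> invariant n \<xi> = invariant n' \<xi>'"
  by (induction rule: markov_equiv.induct) (simp_all add: invariant_conjugate invariant_stabilize)

end

section \<open>The operator of type II as a face model\<close>

text \<open>
  Up to the factor \<open>1/\<surd>2\<close>, the coefficient with which the operator of type II turns the middle bit
  \<open>b'\<close> into \<open>b\<close> between the outer bits \<open>a\<close> and \<open>c\<close>: the weight of a square face with corner
  heights \<open>a, b, c, b'\<close>.
\<close>

definition face_weight :: "real \<Rightarrow> nat \<Rightarrow> nat \<Rightarrow> nat \<Rightarrow> nat \<Rightarrow> complex" where
  "face_weight \<theta> a c b b' =
     (if b = b' then (if a = c then 1 else \<i>)
      else if b = 0 then (- 1) ^ (a * c) * cis \<theta> ^ (a + c)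
      else (- 1) ^ ((1 - a) * (1 - c)) * inverse (cis \<theta>) ^ (a + c))"

lemma less_two_cases: "x < 2 \<Longrightarrow> x = 0 \<or> x = 1" for x :: nat
  by auto

lemma lessThan_two: "{..<2} = {0, 1 :: nat}"
  by auto

lemma face_weight_unitary:
  assumes "a < 2" "c < 2" "b < 2" "b' < 2"
  shows "(\<Sum>x<2. face_weight \<theta> a c b x * cnj (face_weight \<theta> a c b' x)) = (if b = b' then 2 else 0)"
  using assms[THEN less_two_cases]
  by (elim disjE) (simp_all add: face_weight_def lessThan_two cis_cnj cis_inverse cis_mult
    power2_eq_square)

text \<open>
  The star-triangle relation of the face model.  It is the entry of the Yang--Baxter equation from
  \<open>(a, b', c', d)\<close> to \<open>(a, b, c, d)\<close>: three faces tile a hexagon with these heights on its boundary,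
  and the two ways of doing so have the same total weight when the inner height \<open>x\<close> is summed out.
\<close>

lemma face_weight_star_triangle:
  assumes "a < 2" "b < 2" "c < 2" "d < 2" "b' < 2" "c' < 2"
  shows "(\<Sum>x<2. face_weight \<theta> a c b x * face_weight \<theta> x d c c' * face_weight \<theta> a c' x b') =
         (\<Sum>x<2. face_weight \<theta> b d c x * face_weight \<theta> a x b b' * face_weight \<theta> b' d x c')"
  using assms[THEN less_two_cases]
  by (elim disjE) (simp_all add: face_weight_def lessThan_two power2_eq_square field_simps)

lemma R_typeII_carrier: "R_typeII \<theta> \<in> carrier_mat 8 8"
  by (intro carrier_matI) (simp_all add: R_typeII_def Let_def mat_of_rows_list_def)

text \<open>
  The rows and columns of the matrix are bit strings of length three, and the zeros of the matrix say
  that the two outer bits are preserved.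
\<close>

lemma R_typeII_index:
  assumes "i < 8" "j < 8"
  shows "R_typeII \<theta> $$ (i, j) = (if i div 4 = j div 4 \<and> i mod 2 = j mod 2
    then complex_of_real (1 / sqrt 2) * face_weight \<theta> (i div 4) (i mod 2) (i div 2 mod 2) (j div 2
      mod 2) else 0)"
proof -
  have "i \<in> {0, 1, 2, 3, 4, 5, 6, 7}" "j \<in> {0, 1, 2, 3, 4, 5, 6, 7}" using assms by auto
  then show ?thesis
    unfolding R_typeII_def
    by (elim insertE emptyE)
      (simp_all add: Let_def mat_of_rows_list_def face_weight_def power2_eq_square cis_mult)
qed

abbreviation bits3 :: "nat \<Rightarrow> nat \<Rightarrow> nat \<Rightarrow> nat" where "bits3 a b c \<equiv> 4 * a + 2 * b + c"
abbreviation bits4 :: "nat \<Rightarrow> nat \<Rightarrow> nat \<Rightarrow> nat \<Rightarrow> nat" where "bits4 a b c d \<equiv> 8 * a + 4 * b + 2 * c + d"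

lemma ex_bits3: assumes "i < 8" obtains a b c where "a < 2" "b < 2" "c < 2" "i = bits3 a b c"
proof
  show "i div 4 < 2" "i div 2 mod 2 < 2" "i mod 2 < 2" using assms by auto
  show "i = bits3 (i div 4) (i div 2 mod 2) (i mod 2)" by presburger
qed

lemma ex_bits4:
  assumes "i < 16"
  obtains a b c d where "a < 2" "b < 2" "c < 2" "d < 2" "i = bits4 a b c d"
proof -
  have "i div 2 < 8" using assms by auto
  then obtain a b c where abc: "a < 2" "b < 2" "c < 2" "i div 2 = bits3 a b c" by (rule ex_bits3)
  have "i = bits3 a b c * 2 + i mod 2" by (metis abc(4) div_mult_mod_eq)
  then have "i = bits4 a b c (i mod 2)" by simp
  with abc(1-3) show thesis by (intro that[of a b c "i mod 2"]) auto
qed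

lemma bits3_div_mod:
  assumes "a < 2" "b < 2" "c < 2"
  shows "bits3 a b c < 8" "bits3 a b c div 4 = a" "bits3 a b c div 2 mod 2 = b" "bits3 a b c mod 2 = c"
  using assms[THEN less_two_cases] by (elim disjE; simp)+

lemma bits4_div_mod:
  assumes "a < 2" "b < 2" "c < 2" "d < 2"
  shows "bits4 a b c d < 16" "bits4 a b c d div 2 = bits3 a b c" "bits4 a b c d mod 2 = d"
    "bits4 a b c d div 8 = a" "bits4 a b c d mod 8 = bits3 b c d"
  using assms[THEN less_two_cases] by (elim disjE; simp)+

lemma R_typeII_bits:
  assumes "a < 2" "b < 2" "c < 2" "a' < 2" "b' < 2" "c' < 2"
  shows "R_typeII \<theta> $$ (bits3 a b c, bits3 a' b' c') =
    (if a = a' \<and> c = c' then complex_of_real (1 / sqrt 2) * face_weight \<theta> a c b b' else 0)"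
  by (simp only: R_typeII_index bits3_div_mod assms)

lemma kron_R_typeII_left_bits:
  assumes "a < 2" "b < 2" "c < 2" "d < 2" "a' < 2" "b' < 2" "c' < 2" "d' < 2"
  shows "kron (R_typeII \<theta>) (1\<^sub>m 2) $$ (bits4 a b c d, bits4 a' b' c' d') =
    (if a = a' \<and> c = c' \<and> d = d' then complex_of_real (1 / sqrt 2) * face_weight \<theta> a c b b' else 0)"
proof -
  note bits = bits4_div_mod[OF assms(1-4)] bits4_div_mod[OF assms(5-8)]
  have lt: "bits4 a b c d < 8 * 2" "bits4 a' b' c' d' < 8 * 2" using bits(1,6) by simp_all
  have "kron (R_typeII \<theta>) (1\<^sub>m 2) $$ (bits4 a b c d, bits4 a' b' c' d') =
      R_typeII \<theta> $$ (bits3 a b c, bits3 a' b' c') * (if d = d' then 1 else 0)"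
    unfolding index_kron[OF R_typeII_carrier one_carrier_mat[of 2] lt] bits
    by (simp only: index_one_mat assms)
  then show ?thesis by (simp only: R_typeII_bits assms) simp
qed

lemma kron_R_typeII_right_bits:
  assumes "a < 2" "b < 2" "c < 2" "d < 2" "a' < 2" "b' < 2" "c' < 2" "d' < 2"
  shows "kron (1\<^sub>m 2) (R_typeII \<theta>) $$ (bits4 a b c d, bits4 a' b' c' d') =
    (if a = a' \<and> b = b' \<and> d = d' then complex_of_real (1 / sqrt 2) * face_weight \<theta> b d c c' else 0)"
proof -
  note bits = bits4_div_mod[OF assms(1-4)] bits4_div_mod[OF assms(5-8)]
  have lt: "bits4 a b c d < 2 * 8" "bits4 a' b' c' d' < 2 * 8" using bits(1,6) by simp_all
  have "kron (1\<^sub>m 2) (R_typeII \<theta>) $$ (bits4 a b c d, bits4 a' b' c' d') =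
      (if a = a' then 1 else 0) * R_typeII \<theta> $$ (bits3 b c d, bits3 b' c' d')"
    unfolding index_kron[OF one_carrier_mat[of 2] R_typeII_carrier lt] bits
    by (simp only: index_one_mat assms)
  then show ?thesis by (simp only: R_typeII_bits assms) simp
qed

text \<open>
  Products with the padded operator reduce to sums of two terms, because only one bit can change.
\<close>

lemma sum_lessThan_two_points:
  fixes f :: "nat \<Rightarrow> 'a::comm_monoid_add"
  assumes "\<And>k. k < n \<Longrightarrow> (\<And>x. x < 2 \<Longrightarrow> k \<noteq> p x) \<Longrightarrow> f k = 0"
    and "inj_on p {..<2::nat}" "p ` {..<2} \<subseteq> {..<n}"
  shows "(\<Sum>k<n. f k) = (\<Sum>x<2. f (p x))"
proof -
  have "(\<Sum>k<n. f k) = sum f (p ` {..<2})"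
    using assms(1,3) by (intro sum.mono_neutral_right) (auto simp: image_iff)
  also have "\<dots> = (\<Sum>x<2. f (p x))" by (simp add: sum.reindex[OF assms(2)])
  finally show ?thesis .
qed

lemma kron_R_typeII_left_mult:
  assumes "a < 2" "b < 2" "c < 2" "d < 2" "j < 16" and Z: "Z \<in> carrier_mat 16 16"
  shows "(kron (R_typeII \<theta>) (1\<^sub>m 2) * Z) $$ (bits4 a b c d, j) =
    (\<Sum>x<2. complex_of_real (1 / sqrt 2) * face_weight \<theta> a c b x * Z $$ (bits4 a x c d, j))"
proof -
  have X: "kron (R_typeII \<theta>) (1\<^sub>m 2) \<in> carrier_mat 16 16"
    using kron_carrier[OF R_typeII_carrier one_carrier_mat[of 2]] by simp
  have "(kron (R_typeII \<theta>) (1\<^sub>m 2) * Z) $$ (bits4 a b c d, j) =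
      (\<Sum>k<16. kron (R_typeII \<theta>) (1\<^sub>m 2) $$ (bits4 a b c d, k) * Z $$ (k, j))"
    by (rule index_mult_mat_sum[OF X Z bits4_div_mod(1)[OF assms(1-4)] assms(5)])
  also have "\<dots> = (\<Sum>x<2. kron (R_typeII \<theta>) (1\<^sub>m 2) $$ (bits4 a b c d, bits4 a x c d) * Z $$ (bits4 a x
    c d, j))"
  proof (rule sum_lessThan_two_points)
    fix k :: nat assume "k < 16" and k: "\<And>x. x < 2 \<Longrightarrow> k \<noteq> bits4 a x c d"
    from \<open>k < 16\<close> obtain a' b' c' d' where b: "a' < 2" "b' < 2" "c' < 2" "d' < 2" "k =
      bits4 a' b' c' d'"
      by (rule ex_bits4)
    with k[OF b(2)] show "kron (R_typeII \<theta>) (1\<^sub>m 2) $$ (bits4 a b c d, k) * Z $$ (k, j) = 0"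
      by (auto simp only: kron_R_typeII_left_bits[OF assms(1-4) b(1-4)] mult_zero_left split: if_splits)
  next
    show "(\<lambda>x. bits4 a x c d) ` {..<2} \<subseteq> {..<16}" using bits4_div_mod(1)[OF assms(1) _ assms(3,4)]
      by blast
  qed (auto simp: inj_on_def)
  also have "\<dots> = (\<Sum>x<2. complex_of_real (1 / sqrt 2) * face_weight \<theta> a c b x * Z $$ (bits4 a x c d, j))"
    by (intro sum.cong[OF HOL.refl]) (simp only: lessThan_iff kron_R_typeII_left_bits[OF assms(1-4)
      assms(1) _ assms(3,4)] simp_thms if_True)
  finally show ?thesis .
qed

lemma kron_R_typeII_right_mult:
  assumes "a < 2" "b < 2" "c < 2" "d < 2" "j < 16" and Z: "Z \<in> carrier_mat 16 16"
  shows "(kron (1\<^sub>m 2) (R_typeII \<theta>) * Z) $$ (bits4 a b c d, j) =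
    (\<Sum>x<2. complex_of_real (1 / sqrt 2) * face_weight \<theta> b d c x * Z $$ (bits4 a b x d, j))"
proof -
  have X: "kron (1\<^sub>m 2) (R_typeII \<theta>) \<in> carrier_mat 16 16"
    using kron_carrier[OF one_carrier_mat[of 2] R_typeII_carrier] by simp
  have "(kron (1\<^sub>m 2) (R_typeII \<theta>) * Z) $$ (bits4 a b c d, j) =
      (\<Sum>k<16. kron (1\<^sub>m 2) (R_typeII \<theta>) $$ (bits4 a b c d, k) * Z $$ (k, j))"
    by (rule index_mult_mat_sum[OF X Z bits4_div_mod(1)[OF assms(1-4)] assms(5)])
  also have "\<dots> = (\<Sum>x<2. kron (1\<^sub>m 2) (R_typeII \<theta>) $$ (bits4 a b c d, bits4 a b x d) * Z $$ (bits4 a b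
    x d, j))"
  proof (rule sum_lessThan_two_points)
    fix k :: nat assume "k < 16" and k: "\<And>x. x < 2 \<Longrightarrow> k \<noteq> bits4 a b x d"
    from \<open>k < 16\<close> obtain a' b' c' d' where b: "a' < 2" "b' < 2" "c' < 2" "d' < 2" "k =
      bits4 a' b' c' d'"
      by (rule ex_bits4)
    with k[OF b(3)] show "kron (1\<^sub>m 2) (R_typeII \<theta>) $$ (bits4 a b c d, k) * Z $$ (k, j) = 0"
      by (auto simp only: kron_R_typeII_right_bits[OF assms(1-4) b(1-4)] mult_zero_left split:
        if_splits)
  next
    show "(\<lambda>x. bits4 a b x d) ` {..<2} \<subseteq> {..<16}" using bits4_div_mod(1)[OF assms(1,2) _ assms(4)]
      by blast
  qed (auto simp: inj_on_def)
  also have "\<dots> = (\<Sum>x<2. complex_of_real (1 / sqrt 2) * face_weight \<theta> b d c x * Z $$ (bits4 a b x d, j))"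
    by (intro sum.cong[OF HOL.refl]) (simp only: lessThan_iff kron_R_typeII_right_bits[OF assms(1-4)
      assms(1,2) _ assms(4)] simp_thms if_True)
  finally show ?thesis .
qed

text \<open>
  Each of the two products changes only the two inner bits of a string of four, and its entries are
  the two sides of the star-triangle relation.
\<close>

lemma R_typeII_yang_baxter:
  "kron (R_typeII \<theta>) (1\<^sub>m 2) * kron (1\<^sub>m 2) (R_typeII \<theta>) * kron (R_typeII \<theta>) (1\<^sub>m 2) =
   kron (1\<^sub>m 2) (R_typeII \<theta>) * kron (R_typeII \<theta>) (1\<^sub>m 2) * kron (1\<^sub>m 2) (R_typeII \<theta>)"
    (is "?X * ?Y * ?X = ?Y * ?X * ?Y")
proof -
  let ?W = "face_weight \<theta>" and ?s = "complex_of_real (1 / sqrt 2)"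
  have X: "?X \<in> carrier_mat 16 16" and Y: "?Y \<in> carrier_mat 16 16"
    using kron_carrier[OF R_typeII_carrier one_carrier_mat[of 2]] kron_carrier[OF one_carrier_mat[of
      2] R_typeII_carrier]
    by simp_all
  have "?X * (?Y * ?X) = ?Y * (?X * ?Y)"
  proof (rule eq_matI)
    fix i j assume "i < dim_row (?Y * (?X * ?Y))" "j < dim_col (?Y * (?X * ?Y))"
    then have i: "i < 16" and j: "j < 16" using X Y by auto
    from i obtain a b c d where l: "a < 2" "b < 2" "c < 2" "d < 2" "i = bits4 a b c d"
      by (rule ex_bits4)
    from j obtain a' b' c' d' where r: "a' < 2" "b' < 2" "c' < 2" "d' < 2" "j = bits4 a' b' c' d'"
      by (rule ex_bits4)
    have XYX: "(?X * (?Y * ?X)) $$ (i, j) = (\<Sum>x<2. ?s * ?W a c b x * (\<Sum>y<2. ?s * ?W x d c y *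
      ?X $$ (bits4 a x y d, j)))"
      unfolding l(5) kron_R_typeII_left_mult[OF l(1-4) j mult_carrier_mat[OF Y X]]
      by (intro sum.cong[OF HOL.refl]) (simp only: lessThan_iff kron_R_typeII_right_mult[OF l(1) _
        l(3,4) j X])
    have YXY: "(?Y * (?X * ?Y)) $$ (i, j) = (\<Sum>x<2. ?s * ?W b d c x * (\<Sum>y<2. ?s * ?W a x b y *
      ?Y $$ (bits4 a y x d, j)))"
      unfolding l(5) kron_R_typeII_right_mult[OF l(1-4) j mult_carrier_mat[OF X Y]]
      by (intro sum.cong[OF HOL.refl]) (simp only: lessThan_iff kron_R_typeII_left_mult[OF l(1,2) _
        l(4) j Y])
    have innerXYX: "(\<Sum>y<2. ?s * ?W x d c y * ?X $$ (bits4 a x y d, j)) =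
        (if a = a' \<and> d = d' then ?s * ?W x d c c' * (?s * ?W a c' x b') else 0)" if "x < 2" for x
    proof -
      have "(\<Sum>y<2. ?s * ?W x d c y * ?X $$ (bits4 a x y d, j)) =
          (\<Sum>y<2. if y = c' then (if a = a' \<and> d = d' then ?s * ?W x d c c' * (?s * ?W a c' x b') else
            0) else 0)"
        unfolding r(5) using l(1,4) that
        by (intro sum.cong[OF HOL.refl]) (simp only: lessThan_iff kron_R_typeII_left_bits r(1-4), auto)
      then show ?thesis using r(3) by simp
    qed
    have XYX': "(?X * (?Y * ?X)) $$ (i, j) =
        (if a = a' \<and> d = d' then ?s ^ 3 * (\<Sum>x<2. ?W a c b x * ?W x d c c' * ?W a c' x b') else 0)"
    proof -
      have "(\<Sum>x<2. ?s * ?W a c b x * (if P then ?s * ?W x d c c' * (?s * ?W a c' x b') else 0)) =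
          (if P then ?s ^ 3 * (\<Sum>x<2. ?W a c b x * ?W x d c c' * ?W a c' x b') else 0)" for P
        by (cases P) (simp_all only: if_True if_False mult_zero_right mult_zero_left
          sum.neutral_const sum_distrib_left
            power3_eq_cube mult_ac)
      moreover have "(?X * (?Y * ?X)) $$ (i, j) = (\<Sum>x<2. ?s * ?W a c b x * (if a = a' \<and> d =
        d' then ?s * ?W x d c c' * (?s * ?W a c' x b') else 0))"
        unfolding XYX by (rule sum.cong[OF HOL.refl], subst innerXYX, simp, rule HOL.refl)
      ultimately show ?thesis by (simp only:)
    qed
    have innerYXY: "(\<Sum>y<2. ?s * ?W a x b y * ?Y $$ (bits4 a y x d, j)) =
        (if a = a' \<and> d = d' then ?s * ?W a x b b' * (?s * ?W b' d x c') else 0)" if "x < 2" for x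
    proof -
      have "(\<Sum>y<2. ?s * ?W a x b y * ?Y $$ (bits4 a y x d, j)) =
          (\<Sum>y<2. if y = b' then (if a = a' \<and> d = d' then ?s * ?W a x b b' * (?s * ?W b' d x c') else
            0) else 0)"
        unfolding r(5) using l(1,4) that
        by (intro sum.cong[OF HOL.refl]) (simp only: lessThan_iff kron_R_typeII_right_bits r(1-4), auto)
      then show ?thesis using r(2) by simp
    qed
    have YXY': "(?Y * (?X * ?Y)) $$ (i, j) =
        (if a = a' \<and> d = d' then ?s ^ 3 * (\<Sum>x<2. ?W b d c x * ?W a x b b' * ?W b' d x c') else 0)"
    proof -
      have "(\<Sum>x<2. ?s * ?W b d c x * (if P then ?s * ?W a x b b' * (?s * ?W b' d x c') else 0)) =
          (if P then ?s ^ 3 * (\<Sum>x<2. ?W b d c x * ?W a x b b' * ?W b' d x c') else 0)" for P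
        by (cases P) (simp_all only: if_True if_False mult_zero_right mult_zero_left
          sum.neutral_const sum_distrib_left
            power3_eq_cube mult_ac)
      moreover have "(?Y * (?X * ?Y)) $$ (i, j) = (\<Sum>x<2. ?s * ?W b d c x * (if a = a' \<and> d =
        d' then ?s * ?W a x b b' * (?s * ?W b' d x c') else 0))"
        unfolding YXY by (rule sum.cong[OF HOL.refl], subst innerYXY, simp, rule HOL.refl)
      ultimately show ?thesis by (simp only:)
    qed
    show "(?X * (?Y * ?X)) $$ (i, j) = (?Y * (?X * ?Y)) $$ (i, j)"
      unfolding XYX' YXY' face_weight_star_triangle[OF l(1-4) r(2,3)] ..
  qed (use X Y in auto)
  then show ?thesis by (simp only: assoc_mult_mat[OF X Y X] assoc_mult_mat[OF Y X Y])
qed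

text \<open>
  The operator \<open>A\<close> does not change the second tensor factor and depends on its state only through
  what \<open>M\<close> preserves; hence it makes no difference which of the two acts first.
\<close>

lemma controlled_commute:
  assumes A: "A \<in> carrier_mat (p * q) (p * q)" and M: "M \<in> carrier_mat q q"
    and diag: "\<And>u u' v v'. u < p \<Longrightarrow> u' < p \<Longrightarrow> v < q \<Longrightarrow> v' < q \<Longrightarrow> v \<noteq> v' \<Longrightarrow> A $$ (u * q + v, u' * q + v') = 0"
    and const: "\<And>u u' v v'. u < p \<Longrightarrow> u' < p \<Longrightarrow> v < q \<Longrightarrow> v' < q \<Longrightarrow> M $$ (v, v') \<noteq> 0 \<Longrightarrow>
      A $$ (u * q + v, u' * q + v) = A $$ (u * q + v', u' * q + v')"
  shows "A * kron (1\<^sub>m p) M = kron (1\<^sub>m p) M * A"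
proof -
  let ?B = "kron (1\<^sub>m p) M"
  have B: "?B \<in> carrier_mat (p * q) (p * q)" by (rule kron_carrier[OF one_carrier_mat M])
  have idx: "?B $$ (u * q + v, u' * q + v') = (if u = u' then M $$ (v, v') else 0)"
    if "u < p" "u' < p" "v < q" "v' < q" for u u' v v'
    using that mult_add_less[OF that(1,3)] mult_add_less[OF that(2,4)] div_mod_mult_add(1)[OF
      that(3), of _ 1]
      div_mod_mult_add(1)[OF that(4), of _ 1]
    by (simp add: index_kron[OF one_carrier_mat M])
  show ?thesis
  proof (rule eq_matI)
    fix i j assume "i < dim_row (?B * A)" "j < dim_col (?B * A)"
    then have ij: "i < p * q" "j < p * q" using A M by auto
    define u v u' v' where uv: "u = i div q" "v = i mod q" "u' = j div q" "v' = j mod q"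
    have lt: "u < p" "v < q" "u' < p" "v' < q"
      unfolding uv using ij div_less_of_less_mult mod_less_of_less_mult by blast+
    have i: "i = u * q + v" and j: "j = u' * q + v'" by (simp_all add: uv)
    have "(A * ?B) $$ (i, j) = (\<Sum>x<p. \<Sum>y<q. A $$ (i, x * q + y) * ?B $$ (x * q + y, j))"
      unfolding index_mult_mat_sum[OF A B ij] by (rule sum_lessThan_mult)
    also have "\<dots> = (\<Sum>x<p. \<Sum>y<q. if x = u' then if y = v then A $$ (u * q + v, u' * q + v) * M $$ (v,
      v') else 0 else 0)"
      unfolding i j using lt by (intro sum.cong[OF HOL.refl]) (auto simp: idx diag)
    also have "\<dots> = (\<Sum>x<p. if x = u' then A $$ (u * q + v, u' * q + v) * M $$ (v, v') else 0)"
      using lt by (intro sum.cong[OF HOL.refl]) simp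
    also have "\<dots> = A $$ (u * q + v, u' * q + v) * M $$ (v, v')" using lt by simp
    also have "\<dots> = M $$ (v, v') * A $$ (u * q + v', u' * q + v')"
      using const[OF lt(1,3,2,4)] by (cases "M $$ (v, v') = 0") simp_all
    also have "\<dots> = (\<Sum>x<p. if x = u then M $$ (v, v') * A $$ (u * q + v', u' * q + v') else 0)"
      using lt by simp
    also have "\<dots> = (\<Sum>x<p. \<Sum>y<q. if x = u then if y = v' then M $$ (v, v') * A $$ (u * q + v',
      u' * q + v') else 0 else 0)"
      using lt by (intro sum.cong[OF HOL.refl]) simp
    also have "\<dots> = (\<Sum>x<p. \<Sum>y<q. ?B $$ (i, x * q + y) * A $$ (x * q + y, j))"
      unfolding i j using lt by (intro sum.cong[OF HOL.refl]) (auto simp: idx diag)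
    also have "\<dots> = (?B * A) $$ (i, j)"
      unfolding index_mult_mat_sum[OF B A ij] by (rule sum_lessThan_mult[symmetric])
    finally show "(A * ?B) $$ (i, j) = (?B * A) $$ (i, j)" .
  qed (use A M in auto)
qed

lemma R_typeII_nonzero:
  assumes "R_typeII \<theta> $$ (i, j) \<noteq> 0" "i < 8" "j < 8"
  shows "i div 4 = j div 4" "i mod 2 = j mod 2"
  using assms R_typeII_index[OF assms(2,3), of \<theta>] by (auto split: if_splits)

text \<open>
  Padded on the right, the operator changes the second bit of a string and reads the first and the
  third; padded on the left by at least two bits, it changes no bit before the fourth.  So each
  leaves alone all the bits that the other reads or changes.
\<close>

lemma R_typeII_far:
  assumes "4 \<le> j"
  shows "kron (R_typeII \<theta>) (1\<^sub>m (2 ^ (j - 2))) * kron (1\<^sub>m (2 ^ (j - 2))) (R_typeII \<theta>) =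
    kron (1\<^sub>m (2 ^ (j - 2))) (R_typeII \<theta>) * kron (R_typeII \<theta>) (1\<^sub>m (2 ^ (j - 2)))"
proof -
  \<comment> \<open>Two bits on the left are split off: they carry all changes made by the first operator.\<close>
  define r q :: nat where "r = 2 ^ (j - 4)" and "q = 2 ^ (j - 2)"
  let ?R = "R_typeII \<theta>"
  have "j - 2 = (j - 4) + 2" using assms by simp
  then have q: "q = 4 * r" by (simp add: q_def r_def power_add)
  have q0: "0 < q" by (simp add: q_def)
  let ?A = "kron ?R (1\<^sub>m q)" and ?M = "kron (1\<^sub>m r) ?R"
  have "kron (1\<^sub>m q) ?R = kron (1\<^sub>m 4) ?M" by (simp add: q flip: kron_assoc)
  moreover have "?A * kron (1\<^sub>m 4) ?M = kron (1\<^sub>m 4) ?M * ?A"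
  proof (rule controlled_commute)
    show "?A \<in> carrier_mat (4 * (2 * q)) (4 * (2 * q))"
      using kron_carrier[OF R_typeII_carrier one_carrier_mat[of q]] by simp
    show "?M \<in> carrier_mat (2 * q) (2 * q)"
      using kron_carrier[OF one_carrier_mat[of r] R_typeII_carrier] by (simp add: q mult.commute)
    fix u u' v v' :: nat assume uv: "u < 4" "u' < 4" "v < 2 * q" "v' < 2 * q"
    have *: "(x * (2 * q) + y) div q = x * 2 + y div q" "(x * (2 * q) + y) mod q =
      y mod q" for x y :: nat
    proof -
      have "x * (2 * q) + y = y + (x * 2) * q" by simp
      then show "(x * (2 * q) + y) div q = x * 2 + y div q" "(x * (2 * q) + y) mod q = y mod q"
        using q0 by (simp_all only: div_mult_self1 mod_mult_self1)
    qed
    have lt: "u * (2 * q) + x < 8 * q" if "u < 4" "x < 2 * q" for u x :: nat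
      using mult_add_less[OF that] by simp
    have A: "?A $$ (u * (2 * q) + x, u' * (2 * q) + x') =
        ?R $$ (u * 2 + x div q, u' * 2 + x' div q) * (if x mod q = x' mod q then 1 else 0)"
      if "x < 2 * q" "x' < 2 * q" for x x' :: nat
      using q0 unfolding index_kron[OF R_typeII_carrier one_carrier_mat[of q] lt[OF uv(1) that(1)]
        lt[OF uv(2) that(2)]] * by simp
    have vq: "v div q < 2" "v' div q < 2" using uv by (auto simp: div_less_of_less_mult)
    then have lt8: "u * 2 + v div q < 8" "u' * 2 + v' div q < 8" using uv(1,2) by linarith+
    show "?A $$ (u * (2 * q) + v, u' * (2 * q) + v') = 0" if "v \<noteq> v'"
    proof (rule ccontr)
      assume "?A $$ (u * (2 * q) + v, u' * (2 * q) + v') \<noteq> 0"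
      then have "v mod q = v' mod q" "?R $$ (u * 2 + v div q, u' * 2 + v' div q) \<noteq> 0"
        unfolding A[OF uv(3,4)] by (auto split: if_splits)
      moreover from this(2) have "(u * 2 + v div q) mod 2 = (u' * 2 + v' div q) mod 2"
        using R_typeII_nonzero(2) lt8 by blast
      then have "v div q = v' div q" using vq by simp
      ultimately show False using that by (metis div_mult_mod_eq)
    qed
    assume nz: "?M $$ (v, v') \<noteq> 0"
    have lt': "v < r * 8" "v' < r * 8" using uv by (simp_all add: q)
    have "v div 8 = v' div 8" and R: "?R $$ (v mod 8, v' mod 8) \<noteq> 0"
      using nz lt' unfolding index_kron[OF one_carrier_mat[of r] R_typeII_carrier lt']
      by (auto split: if_splits simp: div_less_of_less_mult)
    moreover have "v mod 8 div 4 = v' mod 8 div 4" using R_typeII_nonzero(1)[OF R] by simp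
    moreover have "x div 4 = x div 8 * 2 + x mod 8 div 4" for x :: nat
      using div_mod_mult(1,2)[of x 2 4] div_mult_mod_eq[of "x div 4" 2] by simp
    ultimately have "v div 4 = v' div 4" by metis
    then have "v div q = v' div q" by (simp add: q div_mult2_eq)
    then show "?A $$ (u * (2 * q) + v, u' * (2 * q) + v) = ?A $$ (u * (2 * q) + v', u' * (2 * q) + v')"
      by (simp add: A uv)
  qed
  ultimately show ?thesis by (simp add: q_def)
qed

lemma R_typeII_unitary: "R_typeII \<theta> * mat_adjoint (R_typeII \<theta>) = 1\<^sub>m 8"
proof (rule eq_matI)
  let ?R = "R_typeII \<theta>" and ?W = "face_weight \<theta>" and ?s = "complex_of_real (1 / sqrt 2)"
  note R = R_typeII_carrier[of \<theta>]
  fix i j assume "i < dim_row (1\<^sub>m 8 :: complex mat)" "j < dim_col (1\<^sub>m 8 :: complex mat)"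
  then have i: "i < 8" and j: "j < 8" by auto
  from i obtain a b c where l: "a < 2" "b < 2" "c < 2" "i = bits3 a b c" by (rule ex_bits3)
  from j obtain a' b' c' where r: "a' < 2" "b' < 2" "c' < 2" "j = bits3 a' b' c'" by (rule ex_bits3)
  have s: "?s * ?s = 1 / 2" by (simp flip: of_real_mult)
  have "(?R * mat_adjoint ?R) $$ (i, j) = (\<Sum>k<8. ?R $$ (i, k) * cnj (?R $$ (j, k)))"
    using i j by (simp add: index_mult_mat_sum[OF R mat_adjoint_carrier[OF R]] index_mat_adjoint[OF
      R] del: index_mult_mat(1))
  \<comment> \<open>Row \<open>i\<close> is supported on the strings with the same outer bits as \<open>i\<close>.\<close>
  also have "\<dots> = (\<Sum>x<2. ?R $$ (i, bits3 a x c) * cnj (?R $$ (j, bits3 a x c)))"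
  proof (rule sum_lessThan_two_points)
    fix k :: nat assume "k < 8" and k: "\<And>x. x < 2 \<Longrightarrow> k \<noteq> bits3 a x c"
    from \<open>k < 8\<close> obtain a1 b1 c1 where b: "a1 < 2" "b1 < 2" "c1 < 2" "k = bits3 a1 b1 c1"
      by (rule ex_bits3)
    with k[OF b(2)] show "?R $$ (i, k) * cnj (?R $$ (j, k)) = 0"
      unfolding l(4) by (auto simp only: R_typeII_bits[OF l(1-3) b(1-3)] mult_zero_left split:
        if_splits)
  next
    show "(\<lambda>x. bits3 a x c) ` {..<2} \<subseteq> {..<8}" using bits3_div_mod(1)[OF l(1) _ l(3)] by blast
  qed (auto simp: inj_on_def)
  also have "\<dots> = (\<Sum>x<2. if a = a' \<and> c = c' then (?s * ?s) * (?W a c b x * cnj (?W a c b' x)) else 0)"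
  proof (rule sum.cong[OF HOL.refl])
    fix x :: nat assume "x \<in> {..<2}"
    then have x: "x < 2" by simp
    show "?R $$ (i, bits3 a x c) * cnj (?R $$ (j, bits3 a x c)) =
        (if a = a' \<and> c = c' then (?s * ?s) * (?W a c b x * cnj (?W a c b' x)) else 0)"
      unfolding l(4) r(4) R_typeII_bits[OF l(1-3) l(1) x l(3)] R_typeII_bits[OF r(1-3) l(1) x l(3)]
      by auto
  qed
  also have "\<dots> = (if a = a' \<and> c = c' then (?s * ?s) * (\<Sum>x<2. ?W a c b x * cnj (?W a c b' x)) else 0)"
    by (cases "a = a' \<and> c = c'") (simp_all only: if_True if_False simp_thms sum_distrib_left
      sum.neutral_const)
  also have "\<dots> = (if a = a' \<and> b = b' \<and> c = c' then 1 else 0)"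
    unfolding face_weight_unitary[OF l(1,3,2) r(2)] s by simp
  also have "\<dots> = 1\<^sub>m 8 $$ (i, j)"
  proof -
    have "i = j \<longleftrightarrow> a = a' \<and> b = b' \<and> c = c'"
      using bits3_div_mod[OF l(1-3)] bits3_div_mod[OF r(1-3)] l(4) r(4) by metis
    then show ?thesis using i j by auto
  qed
  finally show "(?R * mat_adjoint ?R) $$ (i, j) = 1\<^sub>m 8 $$ (i, j)" .
qed (use R_typeII_carrier[of \<theta>] in auto)

lemma gyb_operator_R_typeII: "gyb_operator 2 3 1 (R_typeII \<theta>)"
proof -
  note R = R_typeII_carrier[of \<theta>]
  have "mat_adjoint (R_typeII \<theta>) * R_typeII \<theta> = 1\<^sub>m 8"
    by (rule mat_mult_left_right_inverse[OF R mat_adjoint_carrier[OF R] R_typeII_unitary])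
  then have "invertible_mat (R_typeII \<theta>)"
    using R R_typeII_unitary[of \<theta>] unfolding invertible_mat_def inverts_mat_def
    by (intro conjI exI[of _ "mat_adjoint (R_typeII \<theta>)"]) auto
  then show ?thesis
    using R R_typeII_yang_baxter[of \<theta>] R_typeII_far[of _ \<theta>] unfolding gyb_operator_def Let_def
    by simp
qed

lemma unitary_gyb_R_typeII: "unitary_gyb 2 3 1 (R_typeII \<theta>)"
  using gyb_operator_R_typeII[of \<theta>] by unfold_locales (simp_all add: R_typeII_unitary)

section \<open>The enhancement\<close>

text \<open>
  Perpendicularity of the enhancement rests on these two opposite kinds of block structure with
  respect to the last tensor factor.
\<close>

definition preserves_last_bit :: "complex mat \<Rightarrow> bool" where
  "preserves_last_bit A \<longleftrightarrow>
     (\<forall>i<dim_row A. \<forall>j<dim_col A. i mod 2 \<noteq> j mod 2 \<longrightarrow> A $$ (i, j) = 0)"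

definition flips_last_bit :: "complex mat \<Rightarrow> bool" where
  "flips_last_bit A \<longleftrightarrow>
     (\<forall>i<dim_row A. \<forall>j<dim_col A. i mod 2 = j mod 2 \<longrightarrow> A $$ (i, j) = 0)"

lemma trace_adjoint_preserves_flips:
  assumes "A \<in> carrier_mat n n" "B \<in> carrier_mat n n" "preserves_last_bit A" "flips_last_bit B"
  shows "mat_trace (mat_adjoint A * B) = 0"
proof -
  have "mat_adjoint A $$ (i, j) * B $$ (j, i) = 0" if "i < n" "j < n" for i j
    using assms that
    by (cases "i mod 2 = j mod 2")
      (simp_all add: preserves_last_bit_def flips_last_bit_def index_mat_adjoint[OF assms(1)])
  then show ?thesis
    unfolding mat_trace_mult[OF mat_adjoint_carrier[OF assms(1)] assms(2)]
      by (intro sum.neutral ballI) auto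
qed

lemma preserves_last_bit_one: "preserves_last_bit (1\<^sub>m n)"
  by (auto simp: preserves_last_bit_def)

lemma preserves_last_bit_mult:
  assumes A: "A \<in> carrier_mat a b" and B: "B \<in> carrier_mat b c"
    and "preserves_last_bit A" "preserves_last_bit B"
  shows "preserves_last_bit (A * B)"
  unfolding preserves_last_bit_def
proof (intro allI impI)
  fix i j assume "i < dim_row (A * B)" "j < dim_col (A * B)" and ne: "i mod 2 \<noteq> j mod 2"
  then have ij: "i < a" "j < c" using A B by auto
  have "A $$ (i, x) * B $$ (x, j) = 0" if "x < b" for x
    using assms ij ne that by (cases "i mod 2 = x mod 2") (simp_all add: preserves_last_bit_def)
  then show "(A * B) $$ (i, j) = 0"
    unfolding index_mult_mat_sum[OF A B ij] by (intro sum.neutral ballI) auto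
qed

lemma preserves_last_bit_adjoint: "preserves_last_bit A \<Longrightarrow> preserves_last_bit (mat_adjoint A)"
  by (simp add: preserves_last_bit_def index_mat_adjoint[of A "dim_row A" "dim_col A"])

lemma flips_last_bit_adjoint: "flips_last_bit A \<Longrightarrow> flips_last_bit (mat_adjoint A)"
  by (simp add: flips_last_bit_def index_mat_adjoint[of A "dim_row A" "dim_col A"])

lemma preserves_last_bit_kron:
  assumes "even (dim_row B)" "even (dim_col B)" "preserves_last_bit B"
  shows "preserves_last_bit (kron A B)"
  using assms unfolding preserves_last_bit_def
  by (auto simp: kron_def mod_mod_cancel mod_less_of_less_mult)

lemma flips_last_bit_kron:
  assumes "even (dim_row B)" "even (dim_col B)" "flips_last_bit B"
  shows "flips_last_bit (kron A B)"
  using assms unfolding flips_last_bit_def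
  by (auto simp: kron_def mod_mod_cancel mod_less_of_less_mult)

lemma preserves_last_bit_R_typeII: "preserves_last_bit (R_typeII \<theta>)"
  using R_typeII_carrier[of \<theta>] R_typeII_nonzero(2)[of \<theta>] by (auto simp: preserves_last_bit_def)

lemma preserves_last_bit_gen: "preserves_last_bit (gyb_gen 2 1 (R_typeII \<theta>) n i)"
proof -
  let ?q = "2 ^ (1 * (n - i - 1)) :: nat"
  have "preserves_last_bit (kron (R_typeII \<theta>) (1\<^sub>m ?q))"
  proof (cases "n - i - 1")
    case 0
    then show ?thesis using preserves_last_bit_R_typeII kron_one_right by simp
  next
    case (Suc l)
    then show ?thesis by (intro preserves_last_bit_kron preserves_last_bit_one) simp_all
  qed
  then show ?thesis
    unfolding gyb_gen_def
    by (rule preserves_last_bit_kron[rotated 2]) (use R_typeII_carrier[of \<theta>] in simp_all)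
qed

text \<open>
  A generator changes only the middle bit of three consecutive ones, so no braid ever changes the
  last bit of the whole string.
\<close>

lemma preserves_last_bit_rep_word:
  assumes "w \<in> braid_words n"
  shows "preserves_last_bit (gyb_word 2 3 1 (R_typeII \<theta>) n w)"
proof -
  interpret unitary_gyb 2 3 1 "R_typeII \<theta>" by (rule unitary_gyb_R_typeII)
  from assms show ?thesis
  proof (induction w)
    case Nil
    show ?case unfolding rep_word_Nil by (rule preserves_last_bit_one)
  next
    case (Cons l w)
    obtain i b where l: "l = (i, b)" by (cases l)
    have *: "1 \<le> i" "i < n" "w \<in> braid_words n" using Cons.prems l by auto
    have "preserves_last_bit (if b then gen n i else mat_adjoint (gen n i))"
      using preserves_last_bit_gen[of \<theta> n i] preserves_last_bit_adjoint by simp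
    then show ?case
      unfolding l rep_word_Cons[OF *(1,2)]
      by (rule preserves_last_bit_mult[OF letter_carrier[OF *(1,2)] rep_word_carrier[OF *(3)] _
        Cons.IH[OF *(3)]])
  qed
qed

lemma partial_trace_adjoint:
  assumes "m \<le> k" and X: "X \<in> carrier_mat (d ^ k) (d ^ k)"
  shows "partial_trace d k m (mat_adjoint X) = mat_adjoint (partial_trace d k m X)"
proof (rule eq_matI)
  let ?p = "d ^ (k - m)"
  have k: "d ^ k = ?p * d ^ m" using assms(1) by (simp flip: power_add)
  fix i j assume "i < dim_row (mat_adjoint (partial_trace d k m X))" "j < dim_col (mat_adjoint
    (partial_trace d k m X))"
  then have ij: "i < ?p" "j < ?p" by (simp_all add: partial_trace_def)
  then show "partial_trace d k m (mat_adjoint X) $$ (i, j) = mat_adjoint (partial_trace d k m X) $$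
    (i, j)"
    unfolding index_mat_adjoint[OF partial_trace_carrier ij]
    by (simp add: partial_trace_def index_mat_adjoint[OF X] k mult_add_less)
qed (simp_all add: partial_trace_def)

lemma mat_adjoint_minus_smult_one:
  assumes A: "A \<in> carrier_mat n n"
  shows "mat_adjoint (A - c \<cdot>\<^sub>m 1\<^sub>m n) = mat_adjoint A - cnj c \<cdot>\<^sub>m 1\<^sub>m n"
proof (rule eq_matI)
  have carr: "A - c \<cdot>\<^sub>m 1\<^sub>m n \<in> carrier_mat n n" by auto
  fix i j assume "i < dim_row (mat_adjoint A - cnj c \<cdot>\<^sub>m 1\<^sub>m n)" "j < dim_col (mat_adjoint A - cnj c
    \<cdot>\<^sub>m 1\<^sub>m n)"
  then have ij: "i < n" "j < n" by auto
  then show "mat_adjoint (A - c \<cdot>\<^sub>m 1\<^sub>m n) $$ (i, j) = (mat_adjoint A - cnj c \<cdot>\<^sub>m 1\<^sub>m n) $$ (i, j)"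
    unfolding index_mat_adjoint[OF carr ij] using A by (simp add: index_mat_adjoint[OF A])
qed (use A in auto)

text \<open>
  The partial trace over the third bit adds the weights for both values of that bit.  Where the
  second bit stays the same these are \<open>1/\<surd>2\<close> and \<open>\<i>/\<surd>2\<close>, one of each whatever the first bit is, with
  sum \<open>\<alpha>\<close>.  So subtracting \<open>\<alpha>\<close> leaves only the entries that flip the second bit.
\<close>

lemma flips_last_bit_partial_trace_R_typeII:
  "flips_last_bit (partial_trace 2 3 1 (R_typeII \<theta>) - cis (pi / 4) \<cdot>\<^sub>m 1\<^sub>m 4)"
  unfolding flips_last_bit_def
proof (intro allI impI)
  let ?s = "complex_of_real (1 / sqrt 2)"
  fix u v assume "u < dim_row (partial_trace 2 3 1 (R_typeII \<theta>) - cis (pi / 4) \<cdot>\<^sub>m 1\<^sub>m 4)"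
    "v < dim_col (partial_trace 2 3 1 (R_typeII \<theta>) - cis (pi / 4) \<cdot>\<^sub>m 1\<^sub>m 4)" and eq: "u mod 2 =
      v mod 2"
  then have uv: "u < 4" "v < 4" by simp_all
  have bits: "w div 2 < 2" "w * 2 + l = bits3 (w div 2) (w mod 2) l" if "w < 4" for w l :: nat
    using that by presburger+
  have "partial_trace 2 3 1 (R_typeII \<theta>) $$ (u, v) = (\<Sum>l<2. R_typeII \<theta> $$ (u * 2 + l, v * 2 + l))"
    using uv by (simp add: partial_trace_def)
  also have "\<dots> = (\<Sum>l<2. if u div 2 = v div 2 then ?s * (if u div 2 = l then 1 else \<i>) else 0)"
  proof (rule sum.cong[OF HOL.refl])
    fix l :: nat assume "l \<in> {..<2}"
    then have l: "l < 2" by simp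
    have two: "w mod 2 < 2" for w :: nat by simp
    show "R_typeII \<theta> $$ (u * 2 + l, v * 2 + l) = (if u div 2 = v div 2 then ?s * (if u div 2 =
      l then 1 else \<i>) else 0)"
      unfolding bits(2)[OF uv(1)] bits(2)[OF uv(2)] R_typeII_bits[OF bits(1)[OF uv(1)] two l
        bits(1)[OF uv(2)] two l]
      by (simp only: eq face_weight_def simp_thms if_True)
  qed
  also have "\<dots> = (if u div 2 = v div 2 then ?s * (1 + \<i>) else 0)"
    using less_two_cases[OF bits(1)[OF uv(1)]] by (auto simp: lessThan_two distrib_left)
  also have "?s * (1 + \<i>) = cis (pi / 4)"
    by (simp add: complex_eq_iff cos_45 sin_45 real_div_sqrt field_simps)
  also have "u div 2 = v div 2 \<longleftrightarrow> u = v" using eq by (metis div_mult_mod_eq)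
  finally show "(partial_trace 2 3 1 (R_typeII \<theta>) - cis (pi / 4) \<cdot>\<^sub>m 1\<^sub>m 4) $$ (u, v) = 0"
    using uv by simp
qed

lemma perp_rep_of_flips:
  assumes "1 \<le> n" "X \<in> carrier_mat 4 4" "flips_last_bit X"
  shows "kron (1\<^sub>m (2 ^ (n - 1))) X \<in>
    perp (2 ^ gyb_len 3 1 n) (gyb_rep 2 3 1 (R_typeII \<theta>) n ` carrier (braid_group n))"
proof -
  interpret unitary_gyb 2 3 1 "R_typeII \<theta>" by (rule unitary_gyb_R_typeII)
  have "gyb_len 3 1 n = (n - 1) + 2" using assms(1) by (simp add: gyb_len_def)
  then have c: "kron (1\<^sub>m (2 ^ (n - 1))) X \<in> carrier_mat (rep_dim n) (rep_dim n)"
    using kron_carrier[OF one_carrier_mat[of "2 ^ (n - 1)"] assms(2)]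
      by (simp add: power_add mult.commute)
  have "flips_last_bit (kron (1\<^sub>m (2 ^ (n - 1))) X)"
    using assms(2,3) by (intro flips_last_bit_kron) auto
  with c show ?thesis
    unfolding perp_def rep_image
    using trace_adjoint_preserves_flips[OF rep_word_carrier c preserves_last_bit_rep_word] by auto
qed

theorem egyb_operator_R_typeII: "egyb_operator 2 3 1 (R_typeII \<theta>) (1\<^sub>m 2) (cis (pi / 4)) 1"
proof -
  interpret unitary_gyb 2 3 1 "R_typeII \<theta>" by (rule unitary_gyb_R_typeII)
  note R = R_typeII_carrier[of \<theta>]
  let ?Sp = "partial_trace 2 3 1 (R_typeII \<theta>)" and ?a = "cis (pi / 4)"
  have Sp: "?Sp \<in> carrier_mat 4 4" using partial_trace_carrier[of 2 3 1 "R_typeII \<theta>"] by simp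
  have adj: "mat_adjoint (?Sp - ?a \<cdot>\<^sub>m 1\<^sub>m 4) = partial_trace 2 3 1 (mat_adjoint (R_typeII \<theta>)) -
    inverse ?a \<cdot>\<^sub>m 1\<^sub>m 4"
  proof -
    have "mat_adjoint (?Sp - ?a \<cdot>\<^sub>m 1\<^sub>m 4) = mat_adjoint ?Sp - inverse ?a \<cdot>\<^sub>m 1\<^sub>m 4"
      using mat_adjoint_minus_smult_one[OF Sp] by (simp add: cis_cnj)
    then show ?thesis using partial_trace_adjoint[of 1 3 "R_typeII \<theta>" 2] R by simp
  qed
  have flips': "flips_last_bit (partial_trace 2 3 1 (mat_adjoint (R_typeII \<theta>)) - inverse ?a \<cdot>\<^sub>m 1\<^sub>m 4)"
    using flips_last_bit_adjoint[OF flips_last_bit_partial_trace_R_typeII[of \<theta>]] unfolding adj .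
  note flips = flips_last_bit_partial_trace_R_typeII[of \<theta>]
  have e: "kron_pow (1\<^sub>m 2) 3 = 1\<^sub>m 8" "kron_pow (1\<^sub>m 2) (3 - 1) = 1\<^sub>m 4" "\<And>n. kron_pow (1\<^sub>m 2) (1 *
    (n - 1)) = 1\<^sub>m (2 ^ (n - 1))"
    "R_typeII \<theta> * 1\<^sub>m 8 = R_typeII \<theta>" "1\<^sub>m 8 * R_typeII \<theta> = R_typeII \<theta>"
    "mat_adjoint (R_typeII \<theta>) * 1\<^sub>m 8 = mat_adjoint (R_typeII \<theta>)"
    using R mat_adjoint_carrier[OF R] by simp_all
  have c: "X - a \<cdot>\<^sub>m 1\<^sub>m 4 \<in> carrier_mat 4 4" for X and a :: complex by auto
  show ?thesis
    unfolding egyb_operator_def Let_def e mat_inv_R mult_1_right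
    using perp_rep_of_flips[OF _ c flips] perp_rep_of_flips[OF _ c flips'] gyb_operator_R_typeII
    by simp
qed

section \<open>The trivial link as a closed braid\<close>

text \<open>
  The closure of the trivial braid consists of these concentric circles in the plane of height 0.
\<close>

definition flat_circle :: "nat \<Rightarrow> curve" where
  "flat_circle j t = (rcis (real j) (2 * pi * t), 0)"

lemma rcis_zero_eq_iff: "rcis r a = rcis r b \<longleftrightarrow> cis a = cis b" if "r \<noteq> 0" for r :: real
  using that by (simp add: rcis_def)

lemma cis_two_pi_eq_iff: "cis (2 * pi * s) = cis (2 * pi * t) \<longleftrightarrow> s - t \<in> \<int>"
proof -
  have "cis (2 * pi * s) = cis (2 * pi * t) \<longleftrightarrow> (\<exists>n::int. 2 * pi * s = 2 * pi * t + 2 * pi * of_int n)"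
    using sin_cos_eq_iff[of "2 * pi * s" "2 * pi * t"] by (auto simp: complex_eq_iff)
  also have "\<dots> \<longleftrightarrow> (\<exists>n::int. s - t = of_int n)"
  proof -
    have "2 * pi * s = 2 * pi * t + 2 * pi * of_int n \<longleftrightarrow> s - t = of_int n" for n :: int
      by (simp add: diff_eq_eq add.commute flip: distrib_left)
    then show ?thesis by simp
  qed
  finally show ?thesis by (auto simp: Ints_def)
qed

lemma simple_path_flat_circle:
  assumes "1 \<le> j"
  shows "simple_path (flat_circle j)" "pathfinish (flat_circle j) = pathstart (flat_circle j)"
proof -
  have "continuous_on {0..1} (flat_circle j)"
    unfolding flat_circle_def rcis_def cis_conv_exp by (intro continuous_intros)
  moreover have "x = y \<or> x = 0 \<and> y = 1 \<or> x = 1 \<and> y = 0"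
    if "x \<in> {0..1}" "y \<in> {0..1}" "flat_circle j x = flat_circle j y" for x y
  proof -
    have "x - y \<in> \<int>"
      using that(3) assms by (simp add: flat_circle_def rcis_zero_eq_iff cis_two_pi_eq_iff)
    then obtain n where n: "x - y = of_int n" by (auto elim: Ints_cases)
    then have "- 1 \<le> n" "n \<le> 1" using that(1,2) by auto
    then have "n = - 1 \<or> n = 0 \<or> n = 1" by auto
    then show ?thesis using n that(1,2) by auto
  qed
  ultimately show "simple_path (flat_circle j)"
    by (simp add: simple_path_def loop_free_def path_def)
  show "pathfinish (flat_circle j) = pathstart (flat_circle j)"
    by (simp add: pathfinish_def pathstart_def flat_circle_def rcis_def)
qed

lemma cmod_fst_flat_circle: "cmod (fst (flat_circle j t)) = real j"
  by (simp add: flat_circle_def)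

lemma is_braid_closure_flat_circles: "is_braid_closure n [] (map flat_circle [1..<Suc n])"
  unfolding is_braid_closure_def
proof (intro conjI)
  let ?K = "map flat_circle [1..<Suc n]"
  show "oriented_link ?K"
    unfolding oriented_link_def
  proof (intro conjI ballI allI impI)
    fix \<gamma> assume "\<gamma> \<in> set ?K"
    then show "simple_path \<gamma>" "pathfinish \<gamma> = pathstart \<gamma>" using simple_path_flat_circle by auto
  next
    fix i j assume "i < length ?K" "j < length ?K" "i \<noteq> j"
    then have "flat_circle (Suc i) s \<noteq> flat_circle (Suc j) t" for s t
      using cmod_fst_flat_circle[of "Suc i" s] cmod_fst_flat_circle[of "Suc j" t] by auto
    with \<open>i < length ?K\<close> \<open>j < length ?K\<close> have "(?K ! i) s \<noteq> (?K ! j) t" for s t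
      by (simp del: upt_Suc)
    then show "path_image (?K ! i) \<inter> path_image (?K ! j) = {}"
      unfolding path_image_def by blast
  qed
  have "closed_braid n [] = (\<Union>j\<in>{1..n}. flat_circle j ` {0..1})"
    unfolding closed_braid_def flat_circle_def by (auto simp: image_iff) force+
  then show "(\<Union>\<gamma>\<in>set ?K. path_image \<gamma>) = closed_braid n []"
    by (simp add: path_image_def atLeastLessThanSuc_atLeastAtMost del: upt_Suc)
  show "\<forall>\<gamma>\<in>set ?K. \<exists>\<phi>. continuous_on {0..1} \<phi> \<and> strict_mono_on {0..1} \<phi> \<and>
        (\<forall>t\<in>{0..1}. fst (\<gamma> t) = rcis (cmod (fst (\<gamma> t))) (\<phi> t))"
  proof
    fix \<gamma> assume "\<gamma> \<in> set ?K"
    then obtain j where "\<gamma> = flat_circle j" by auto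
    then show "\<exists>\<phi>. continuous_on {0..1} \<phi> \<and> strict_mono_on {0..1} \<phi> \<and>
        (\<forall>t\<in>{0..1}. fst (\<gamma> t) = rcis (cmod (fst (\<gamma> t))) (\<phi> t))"
      by (intro exI[of _ "\<lambda>t. 2 * pi * t"])
        (auto simp: flat_circle_def strict_mono_on_def intro!: continuous_intros)
  qed
qed

text \<open>
  Moving every point upwards by its distance from the axis takes the circle of radius \<open>j\<close> from
  height 0 to height \<open>j\<close>, that is, to the \<open>j\<close>-th component of the trivial link.
\<close>

lemma ambient_isotopy_lift: "ambient_isotopy (\<lambda>t x. (fst x, snd x + t * cmod (fst x)))"
  unfolding ambient_isotopy_def
proof (intro conjI ballI allI)
  show "continuous_on ({0..1} \<times> UNIV) (\<lambda>(t, x :: space). (fst x, snd x + t * cmod (fst x)))"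
    unfolding case_prod_beta by (intro continuous_intros)
  fix t :: real
  show "\<exists>g. homeomorphism UNIV UNIV (\<lambda>x :: space. (fst x, snd x + t * cmod (fst x))) g"
    by (rule exI[of _ "\<lambda>x. (fst x, snd x - t * cmod (fst x))"], rule homeomorphismI)
      (auto intro!: continuous_intros)
qed simp

lemma link_isotopic_flat_circles: "link_isotopic (map flat_circle [1..<Suc n]) (trivial_link n)"
  unfolding link_isotopic_def
proof (intro exI conjI allI impI)
  let ?H = "\<lambda>t (x :: space). (fst x, snd x + t * cmod (fst x))" and ?K = "map flat_circle [1..<Suc n]"
  show "ambient_isotopy ?H" by (rule ambient_isotopy_lift)
  show "bij_betw id {..<length ?K} {..<length (trivial_link n)}"
    by (simp add: trivial_link_def del: upt_Suc)
  fix i assume i: "i < length ?K"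
  have "flat_circle (Suc i) (frac t) = flat_circle (Suc i) t" if "t \<in> {0..1}" for t
    using that by (cases "t = 1") (auto simp: flat_circle_def rcis_def frac_eq)
  then have "\<forall>t\<in>{0..1}. (trivial_link n ! i) t = (?H 1 \<circ> ?K ! i) (frac t)"
    using i by (simp add: trivial_link_def flat_circle_def del: upt_Suc)
  then show "same_oriented_loop (?H 1 \<circ> ?K ! i) (trivial_link n ! id i)"
    unfolding same_oriented_loop_def
    by (intro exI[of _ "\<lambda>t. t"]) (auto simp: strict_mono_on_def)
qed

lemma closure_isotopic_trivial_link: "closure_isotopic_to n (braid_class n []) (trivial_link n)"
  unfolding closure_isotopic_to_def
  using mem_braid_class[of "[]" n] is_braid_closure_flat_circles link_isotopic_flat_circles by auto

theorem theorem4p1p3: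
  fixes \<theta> :: real and R \<mu> :: "complex mat" and \<alpha> \<beta> :: complex
  assumes "0 \<le> \<theta>" and "\<theta> \<le> pi"
  defines "R \<equiv> R_typeII \<theta>" and "\<mu> \<equiv> 1\<^sub>m 2" and "\<alpha> \<equiv> cis (pi / 4)" and "\<beta> \<equiv> 1"
  shows
    "egyb_operator 2 3 1 R \<mu> \<alpha> \<beta> \<and>
     (\<forall>n \<xi> n' \<xi>'. markov_equiv n \<xi> n' \<xi>' \<longrightarrow>
        braid_invariant 2 3 1 R \<mu> \<alpha> \<beta> n \<xi> = braid_invariant 2 3 1 R \<mu> \<alpha> \<beta> n' \<xi>') \<and>
     (\<forall>n\<ge>1. \<exists>\<xi>\<in>carrier (braid_group n). closure_isotopic_to n \<xi> (trivial_link n) \<and>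
        braid_invariant 2 3 1 R \<mu> \<alpha> \<beta> n \<xi> = 2 ^ (n + 1)) \<and>
     (markov_theorem \<longrightarrow>
        (\<forall>L. \<forall>n\<ge>1. \<forall>\<xi>\<in>carrier (braid_group n). closure_isotopic_to n \<xi> L \<longrightarrow>
           braid_link_invariant 2 3 1 R \<mu> \<alpha> \<beta> L = braid_invariant 2 3 1 R \<mu> \<alpha> \<beta> n \<xi>) \<and>
        (\<forall>n\<ge>1. braid_link_invariant 2 3 1 R \<mu> \<alpha> \<beta> (trivial_link n) = 2 ^ (n + 1)))"
proof -
  interpret unitary_egyb 2 3 1 R \<mu> \<alpha> \<beta>
    unfolding R_def \<mu>_def \<alpha>_def \<beta>_def
    by (intro unitary_egyb.intro unitary_egyb_axioms.intro unitary_gyb_R_typeII egyb_operator_R_typeII)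
  have unlink: "\<exists>\<xi>\<in>carrier (braid_group n). closure_isotopic_to n \<xi> (trivial_link n) \<and> invariant n \<xi>
    = 2 ^ (n + 1)"
    if "1 \<le> n" for n
  proof (intro bexI conjI)
    have len: "gyb_len 3 1 n = n + 1" using that by (simp add: gyb_len_def)
    have "word_trace n [] = mat_trace (1\<^sub>m (2 ^ (n + 1)) * 1\<^sub>m (2 ^ (n + 1)))"
      unfolding word_trace_def rep_word_Nil len unfolding \<mu>_def kron_pow_one ..
    then have "word_trace n [] = 2 ^ (n + 1)" by simp
    then show "invariant n (braid_class n []) = 2 ^ (n + 1)"
      unfolding invariant_braid_class[OF braid_words_simps(1)] by (simp only: word_exponent_Nil)
        (simp add: \<beta>_def)
  qed (simp_all add: closure_isotopic_trivial_link braid_class_carrier)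
  have link: "braid_link_invariant 2 3 1 R \<mu> \<alpha> \<beta> L = invariant n \<xi>"
    if markov_theorem "1 \<le> n" "\<xi> \<in> carrier (braid_group n)" "closure_isotopic_to n \<xi> L" for L n \<xi>
    unfolding braid_link_invariant_def
  proof (rule the_equality)
    show "\<exists>p\<ge>1. \<exists>\<eta>\<in>carrier (braid_group p). closure_isotopic_to p \<eta> L \<and> invariant n \<xi> = invariant p \<eta>"
      using that(2-4) by blast
  next
    fix c assume "\<exists>n\<ge>1. \<exists>\<xi>\<in>carrier (braid_group n). closure_isotopic_to n \<xi> L \<and> c = invariant n \<xi>"
    then obtain n' \<xi>' where "1 \<le> n'" "\<xi>' \<in> carrier (braid_group n')" "closure_isotopic_to n' \<xi>' L"
      "c = invariant n' \<xi>'"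
      by blast
    with that show "c = invariant n \<xi>"
      using invariant_markov unfolding markov_theorem_def by blast
  qed
  show ?thesis
  proof (intro conjI allI impI)
    show "egyb_operator 2 3 1 R \<mu> \<alpha> \<beta>" by (rule egyb)
  next
    fix n \<xi> n' \<xi>' assume "markov_equiv n \<xi> n' \<xi>'"
    then show "invariant n \<xi> = invariant n' \<xi>'" by (rule invariant_markov)
  next
    fix n :: nat assume "1 \<le> n"
    then show "\<exists>\<xi>\<in>carrier (braid_group n). closure_isotopic_to n \<xi> (trivial_link n) \<and> invariant n \<xi> =
      2 ^ (n + 1)"
      by (rule unlink)
  next
    assume markov_theorem
    then show "\<forall>\<xi>\<in>carrier (braid_group n). closure_isotopic_to n \<xi> L \<longrightarrow>
        braid_link_invariant 2 3 1 R \<mu> \<alpha> \<beta> L = invariant n \<xi>" if "1 \<le> n" for L n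
      using link that by blast
  next
    fix n :: nat assume markov_theorem "1 \<le> n"
    then show "braid_link_invariant 2 3 1 R \<mu> \<alpha> \<beta> (trivial_link n) = 2 ^ (n + 1)"
      using unlink[of n] link by metis
  qed
qed

end
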